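(* Let $X$ be a complex Banach space. Let $A_0:\operatorname{dom}(A_0)\subseteq X\to X$ and $B_0:\operatorname{dom}(B_0)\subseteq X\to X$ be generators of $C_0$-groups on $X$, let $W_0\in\mathcal B(\operatorname{dom}(A_0),X)$ and $B_1,\widetilde B_1\in\mathcal B(X)$, and assume: (i) $A_0B_0=B_0A_0$ (i.e. $A_0$ and $B_0$ commute, in the sense recalled in the context); (ii) $\operatorname{dom}(A_0)\subseteq\operatorname{dom}(B_0)$ and $B_0(\operatorname{dom}(A_0^2))\subseteq\operatorname{dom}(A_0)$; (iii) the operators $A_0^{\pm}:=\pm A_0-B_0$, with domain $\operatorname{dom}(A_0)$, generate $C_0$-groups on $X$; (iv) $B_1(\operatorname{dom}(A_0))\subseteq\operatorname{dom}(A_0)$ and $B_1|_{\operatorname{dom}(A_0)}\in\mathcal B(\operatorname{dom}(A_0))$; (v) $(B_0B_1-B_1B_0)x=\widetilde B_1x$ for every $x\in\operatorname{dom}(A_0^2)$; (vi) $A=A_0^2-B_0^2+W_0$ with $\operatorname{dom}(A)=\operatorname{dom}(A_0^2)$, and $B=B_0+B_1$ with $\operatorname{dom}(B)=\operatorname{dom}(B_0)$. Set $Y=\operatorname{dom}(A_0)$ (with the graph norm). Then: $A$ and $B$ are closed linear operators, $\rho(B)\neq\emptyset$, $Y$ is a Banach space continuously embedded in $X$, and (1) $\operatorname{dom}(A)\subseteq\operatorname{dom}(B^2)\cap Y$; (2) $B(\operatorname{dom}(A))\subseteq Y\subseteq\operatorname{dom}(B)$; (3) the operator $G:\operatorname{dom}(A)\times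 Y\subseteq Y\times X\to Y\times X$, $$G=\begin{bmatrix}-B&I\\ A+B^2&-B\end{bmatrix},$$ generates a $C_0$-group on $Y\times X=\operatorname{dom}(A_0)\times X$.
   Context: Domains of closed operators are endowed with the graph norm $\|x\|_{\operatorname{dom}(T)}=\|x\|+\|Tx\|$. $\mathcal B(V,W)$ denotes the bounded linear operators from $V$ to $W$, $\mathcal B(V)=\mathcal B(V,V)$; $\rho(\cdot)$ is the resolvent set and $R(\mu,T)=(\mu I-T)^{-1}$. Commutation $A_0B_0=B_0A_0$ of the (unbounded) group generators $A_0,B_0$ means that their resolvents commute: $R(\lambda,A_0)R(\mu,B_0)=R(\mu,B_0)R(\lambda,A_0)$ for all $\lambda\in\rho(A_0)$, $\mu\in\rho(B_0)$. *)

theory Defs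
  imports "HOL-Analysis.Analysis"
begin

section \<open>Complex Banach spaces\<close>

class complex_vector = real_vector +
  fixes scaleC :: "complex \<Rightarrow> 'a \<Rightarrow> 'a"  (infixr \<open>*\<^sub>C\<close> 75)
  assumes scaleC_add_right: "c *\<^sub>C (x + y) = c *\<^sub>C x + c *\<^sub>C y"
    and scaleC_add_left: "(c + d) *\<^sub>C x = c *\<^sub>C x + d *\<^sub>C x"
    and scaleC_scaleC: "c *\<^sub>C d *\<^sub>C x = (c * d) *\<^sub>C x"
    and scaleC_one: "1 *\<^sub>C x = x"
    and scaleR_scaleC: "r *\<^sub>R x = complex_of_real r *\<^sub>C x"

class complex_normed_vector = complex_vector + real_normed_vector +
  assumes norm_scaleC: "norm (c *\<^sub>C x) = cmod c * norm x"

class cbanach = complex_normed_vector + banach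

global_interpretation complex_vector:
  vector_space "scaleC :: complex \<Rightarrow> 'a \<Rightarrow> 'a::complex_vector"
  by unfold_locales
    (simp_all add: scaleC_add_right scaleC_add_left scaleC_scaleC scaleC_one)

instantiation prod :: (complex_vector, complex_vector) complex_vector
begin

definition scaleC_prod :: "complex \<Rightarrow> 'a \<times> 'b \<Rightarrow> 'a \<times> 'b"
  where "scaleC_prod c p = (c *\<^sub>C fst p, c *\<^sub>C snd p)"

instance
  by standard
    (auto simp: scaleC_prod_def scaleR_prod_def scaleC_add_right scaleC_add_left
      scaleC_scaleC scaleC_one scaleR_scaleC)

end


section \<open>Normed spaces on a carrier\<close>

text \<open>
  The domain of a closed operator with its graph norm is not a type.  A normed space is therefore
  given by a complex subspace \<open>V\<close> of an ambient complex vector space and a function \<open>N\<close> that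
  matters only on \<open>V\<close>.  The whole space is \<open>UNIV\<close> with \<open>norm\<close>.
\<close>

definition normed_space_on :: "'v::complex_vector set \<Rightarrow> ('v \<Rightarrow> real) \<Rightarrow> bool"
  where "normed_space_on V N \<longleftrightarrow>
    complex_vector.subspace V \<and>
    (\<forall>x\<in>V. 0 \<le> N x \<and> (N x = 0 \<longleftrightarrow> x = 0)) \<and>
    (\<forall>x\<in>V. \<forall>y\<in>V. N (x + y) \<le> N x + N y) \<and>
    (\<forall>c. \<forall>x\<in>V. N (c *\<^sub>C x) = cmod c * N x)"

definition banach_space_on :: "'v::complex_vector set \<Rightarrow> ('v \<Rightarrow> real) \<Rightarrow> bool"
  where "banach_space_on V N \<longleftrightarrow>
    normed_space_on V N \<and>
    (\<forall>s::nat \<Rightarrow> 'v. range s \<subseteq> V \<longrightarrow>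
      (\<forall>e>0. \<exists>k. \<forall>m\<ge>k. \<forall>n\<ge>k. N (s m - s n) < e) \<longrightarrow>
      (\<exists>x\<in>V. (\<lambda>n. N (s n - x)) \<longlonglongrightarrow> 0))"

definition continuously_embedded ::
    "'v::complex_vector set \<Rightarrow> ('v \<Rightarrow> real) \<Rightarrow> 'v set \<Rightarrow> ('v \<Rightarrow> real) \<Rightarrow> bool"
  where "continuously_embedded V N W M \<longleftrightarrow> V \<subseteq> W \<and> (\<exists>C. \<forall>x\<in>V. M x \<le> C * N x)"


section \<open>Linear operators\<close>

text \<open>
  An operator is given by its domain \<open>D\<close> and a total function of which only the values on \<open>D\<close> count.
\<close>

definition clinear_on :: "'v::complex_vector set \<Rightarrow> ('v \<Rightarrow> 'w::complex_vector) \<Rightarrow> bool"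
  where "clinear_on D T \<longleftrightarrow>
    complex_vector.subspace D \<and>
    (\<forall>x\<in>D. \<forall>y\<in>D. T (x + y) = T x + T y) \<and>
    (\<forall>c. \<forall>x\<in>D. T (c *\<^sub>C x) = c *\<^sub>C T x)"

definition bounded_operator ::
    "'v::complex_vector set \<Rightarrow> ('v \<Rightarrow> real) \<Rightarrow> 'w::complex_vector set \<Rightarrow> ('w \<Rightarrow> real) \<Rightarrow> ('v \<Rightarrow> 'w) \<Rightarrow> bool"
  where "bounded_operator V N W M T \<longleftrightarrow>
    clinear_on V T \<and> T ` V \<subseteq> W \<and> (\<exists>C. \<forall>x\<in>V. M (T x) \<le> C * N x)"

definition closed_operator :: "'a::cbanach set \<Rightarrow> ('a \<Rightarrow> 'a) \<Rightarrow> bool"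
  where "closed_operator D T \<longleftrightarrow> clinear_on D T \<and> closed ((\<lambda>x. (x, T x)) ` D)"

definition graph_norm :: "('a::cbanach \<Rightarrow> 'a) \<Rightarrow> 'a \<Rightarrow> real"
  where "graph_norm T x = norm x + norm (T x)"

definition dom_square :: "'a set \<Rightarrow> ('a \<Rightarrow> 'a) \<Rightarrow> 'a set"
  where "dom_square D T = {x \<in> D. T x \<in> D}"

definition resolvent :: "'a::cbanach set \<Rightarrow> ('a \<Rightarrow> 'a) \<Rightarrow> complex \<Rightarrow> 'a \<Rightarrow> 'a"
  where "resolvent D T \<mu> = inv_into D (\<lambda>x. \<mu> *\<^sub>C x - T x)"

definition resolvent_set :: "'a::cbanach set \<Rightarrow> ('a \<Rightarrow> 'a) \<Rightarrow> complex set"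
  where "resolvent_set D T =
    {\<mu>. bij_betw (\<lambda>x. \<mu> *\<^sub>C x - T x) D UNIV \<and>
         bounded_operator UNIV norm UNIV norm (resolvent D T \<mu>)}"

definition resolvents_commute ::
    "'a::cbanach set \<Rightarrow> ('a \<Rightarrow> 'a) \<Rightarrow> 'a set \<Rightarrow> ('a \<Rightarrow> 'a) \<Rightarrow> bool"
  where "resolvents_commute D S E T \<longleftrightarrow>
    (\<forall>\<nu>\<in>resolvent_set D S. \<forall>\<mu>\<in>resolvent_set E T.
      resolvent D S \<nu> \<circ> resolvent E T \<mu> = resolvent E T \<mu> \<circ> resolvent D S \<nu>)"


section \<open>Strongly continuous groups\<close>

definition C0_group ::
    "'v::complex_vector set \<Rightarrow> ('v \<Rightarrow> real) \<Rightarrow> (real \<Rightarrow> 'v \<Rightarrow> 'v) \<Rightarrow> bool"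
  where "C0_group V N U \<longleftrightarrow>
    (\<forall>t. bounded_operator V N V N (U t)) \<and>
    (\<forall>x\<in>V. U 0 x = x) \<and>
    (\<forall>s t. \<forall>x\<in>V. U (s + t) x = U s (U t x)) \<and>
    (\<forall>x\<in>V. \<forall>t. ((\<lambda>s. N (U s x - U t x)) \<longlongrightarrow> 0) (at t))"

text \<open>
  The equivalence below fixes the domain as well as the values: \<open>D\<close> is the set of all \<open>x \<in> V\<close> at which
  the difference quotient has a limit in \<open>(V, N)\<close>.
\<close>

definition is_generator ::
    "'v::complex_vector set \<Rightarrow> ('v \<Rightarrow> real) \<Rightarrow> (real \<Rightarrow> 'v \<Rightarrow> 'v) \<Rightarrow> 'v set \<Rightarrow> ('v \<Rightarrow> 'v) \<Rightarrow> bool"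
  where "is_generator V N U D T \<longleftrightarrow>
    D \<subseteq> V \<and> T ` D \<subseteq> V \<and>
    (\<forall>x\<in>V. \<forall>y\<in>V.
      ((\<lambda>h. N ((1 / h) *\<^sub>R (U h x - x) - y)) \<longlongrightarrow> 0) (at 0) \<longleftrightarrow> x \<in> D \<and> T x = y)"

definition generates_C0_group ::
    "'v::complex_vector set \<Rightarrow> ('v \<Rightarrow> real) \<Rightarrow> 'v set \<Rightarrow> ('v \<Rightarrow> 'v) \<Rightarrow> bool"
  where "generates_C0_group V N D T \<longleftrightarrow> (\<exists>U. C0_group V N U \<and> is_generator V N U D T)"

end

(*
  On Y x X the operator G is a bounded perturbation of the block operator with rows (-B0, I) and
  (A0^2, -B0), because A + B^2 - A0^2 = W0 + 2 B1 B0 + B1' + B1^2 maps Y boundedly into X.  With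
  C = l - A0 invertible, C^2 differs from A0^2 only by a bounded operator from Y to X, and the
  isomorphism (u, v) |-> (v + C u, v - C u) from Y x X onto X x X turns the block operator with C^2
  in place of A0^2 into diag(-B0 + C, -B0 - C).  This generates a group by (iii), up to the bounded
  summand diag(l, -l), since C and B0 commute on the domain of A0^2.

  For the closedness of A, factor A0^2 - B0^2 = (A0 - B0)(A0 + B0).  The two factors have the same
  domain as A0, so each of them bounds A0 up to lower order terms, whence |A0^2 x| is bounded by
  |A x| + |x| + |A0 x|.  The last term is absorbed by |A0 x| <= e |A0^2 x| + C |x|.
*)
theory Submission
  imports Defs
begin

text \<open>Passing from \<open>A0\<close> to \<open>C = l - A0\<close> is forced: \<open>A0\<close>
  need not be injective, so v + A0 u and v - A0 u need not be coordinates on Y x X, whereas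
  \<open>C\<close> maps Y isomorphically onto X once l is a resolvent point. The coordinates come
  from the system u' = v - B0 u, v' = C^2 u - B0 v: since C and B0 commute, p = v + C u and q = v -
  C u satisfy the decoupled equations p' = (C - B0) p and q' = (-C - B0) q. What has to be tracked
  throughout is the exact domain. \<open>is_generator\<close> asks for precisely the set of vectors
  with differentiable orbit, so rescaling, bounded perturbation and similarity are each proved as
  equivalences of differentiability at 0. The group theory is carried out with real scalars on a
  Banach type; complex linearity travels along as commutation with each scalar multiplication. Since
  Y is only a carrier with a graph norm, the group for G is built on X x X and pulled back.\<close>

lemma uniform_boundedness:
  fixes f :: "'i \<Rightarrow> 'a::banach \<Rightarrow> 'b::real_normed_vector"
  assumes lin: "\<And>i. i \<in> I \<Longrightarrow> bounded_linear (f i)"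
    and pointwise: "\<And>x. \<exists>K. \<forall>i\<in>I. norm (f i x) \<le> K"
  shows "\<exists>C\<ge>0. \<forall>i\<in>I. \<forall>x. norm (f i x) \<le> C * norm x"
proof -
  \<comment> \<open>Baire category: these closed sets cover the space, so one of them contains a
    ball of radius \<open>r\<close> about some \<open>a\<close>. For \<open>y\<close> of norm
    \<open>r\<close>, both \<open>a + y\<close> and \<open>a\<close> lie in that ball, and
    subtracting the two bounds removes the unknown centre.\<close>
  define E where "E n = {x. \<forall>i\<in>I. norm (f i x) \<le> real n}" for n
  have "closed (E n)" for n
  proof -
    have "E n = (\<Inter>i\<in>I. {x. norm (f i x) \<le> real n})" by (auto simp: E_def)
    moreover have "closed {x. norm (f i x) \<le> real n}" if "i \<in> I" for i
      using lin[OF that] by (intro closed_Collect_le continuous_intros linear_continuous_on)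
    ultimately show ?thesis by auto
  qed
  moreover have "x \<in> \<Union>(range E)" for x
  proof -
    obtain K where "\<forall>i\<in>I. norm (f i x) \<le> K" using pointwise by blast
    moreover obtain n where "K \<le> real n" using real_arch_simple by blast
    ultimately have "x \<in> E n" unfolding E_def using order_trans by blast
    then show ?thesis by blast
  qed
  then have "\<Union>(range E) = UNIV" by blast
  ultimately obtain n where "interior (E n) \<noteq> {}"
    using Baire_category_alt[of "euclidean :: 'a topology" "range E"]
      completely_metrizable_space_euclidean by force
  then obtain a r where r: "r > 0" "cball a r \<subseteq> E n"
    by (metis all_not_in_conv mem_interior_cball)
  have "norm (f i x) \<le> (2 * real n / r) * norm x" if i: "i \<in> I" for i x
  proof (cases "x = 0")
    case True
    then show ?thesis using lin[OF i] by (simp add: linear_simps)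
  next
    case False
    interpret bounded_linear "f i" by (rule lin[OF i])
    define y where "y = (r / norm x) *\<^sub>R x"
    have "norm y = r" using False r by (simp add: y_def)
    then have "a + y \<in> E n" "a \<in> E n" using r by (auto simp: dist_norm)
    then have "norm (f i (a + y)) \<le> n" "norm (f i a) \<le> n" using i by (auto simp: E_def)
    moreover have "f i y = f i (a + y) - f i a" by (simp add: add)
    ultimately have "norm (f i y) \<le> 2 * real n"
      using norm_triangle_ineq4[of "f i (a + y)" "f i a"] by simp
    moreover have "norm (f i y) = r / norm x * norm (f i x)"
      using r by (simp add: y_def scaleR)
    ultimately show ?thesis using False r by (simp add: field_simps)
  qed
  then show ?thesis using r by (intro exI[of _ "2 * real n / r"]) auto
qed

section \<open>Primitives and growth estimates for vector-valued functions of a real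
  variable\<close>

lemma primitive_exists:
  fixes g :: "real \<Rightarrow> 'a::banach"
  assumes g: "continuous_on UNIV g"
  shows "\<exists>G. G 0 = 0 \<and> (\<forall>t. (G has_vector_derivative g t) (at t))"
proof -
  \<comment> \<open>Integrating from \<open>-b\<close> and subtracting the value at 0 handles both
    signs of \<open>t\<close> in one formula. The result does not depend on \<open>b\<close> as long
    as \<open>b\<close> is at least the modulus of \<open>t\<close>.\<close>
  define J where "J b t = integral {-b..t} g - integral {-b..0} g" for b t :: real
  have int: "g integrable_on {a..b}" for a b
    by (intro integrable_continuous_real continuous_on_subset[OF g]) auto
  have J_eq: "J b t = J c t" if "\<bar>t\<bar> \<le> b" "b \<le> c" for b c t
  proof -
    have eq: "integral {-c..s} g = integral {-c..-b} g + integral {-b..s} g" if "-b \<le> s" for s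
      using that \<open>b \<le> c\<close>
      by (intro Henstock_Kurzweil_Integration.integral_combine[symmetric] int) auto
    have "-b \<le> t" "-b \<le> 0" using that by auto
    from this[THEN eq] show ?thesis by (simp add: J_def)
  qed
  have J_deriv: "(J b has_vector_derivative g t) (at t)" if "\<bar>t\<bar> < b" for b t
  proof -
    have t: "t \<in> interior {-b..b}" using that by (simp add: abs_less_iff)
    have "((\<lambda>t. integral {-b..t} g) has_vector_derivative g t) (at t within {-b..b})"
      by (rule integral_has_vector_derivative[OF continuous_on_subset[OF g]])
        (use that in auto)
    then have "((\<lambda>t. integral {-b..t} g) has_vector_derivative g t) (at t)"
      unfolding at_within_interior[OF t] .
    then have "((\<lambda>t. integral {-b..t} g - integral {-b..0} g) has_vector_derivative g t - 0) (at t)"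
      by (intro derivative_intros)
    then show ?thesis by (simp add: J_def[abs_def])
  qed
  \<comment> \<open>The window grows with \<open>t\<close>; for \<open>s\<close> within distance 1
    of \<open>t\<close> it stays inside the fixed window of radius \<open>\<bar>t\<bar> + 2\<close>,
    so \<open>G\<close> agrees locally with one differentiable \<open>J\<close>.\<close>
  define G where "G t = J (\<bar>t\<bar> + 1) t" for t
  have "(G has_vector_derivative g t) (at t)" for t
  proof (rule has_vector_derivative_transform_within_open[OF J_deriv, of t "\<bar>t\<bar> + 2"])
    show "J (\<bar>t\<bar> + 2) s = G s" if "s \<in> {t-1<..<t+1}" for s
      using that unfolding G_def by (intro J_eq[symmetric]) auto
  qed auto
  moreover have "G 0 = 0" by (simp add: G_def J_def)
  ultimately show ?thesis by blast
qed

definition primitive :: "(real \<Rightarrow> 'a::banach) \<Rightarrow> real \<Rightarrow> 'a"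
  where "primitive g = (SOME G. G 0 = 0 \<and> (\<forall>t. (G has_vector_derivative g t) (at t)))"

lemma
  fixes g :: "real \<Rightarrow> 'a::banach"
  assumes "continuous_on UNIV g"
  shows primitive_0: "primitive g 0 = 0"
    and primitive_deriv: "(primitive g has_vector_derivative g t) (at t)"
  using someI_ex[OF primitive_exists[OF assms]] by (auto simp: primitive_def)

lemma vector_derivative_continuous_on:
  fixes f :: "real \<Rightarrow> 'a::real_normed_vector"
  assumes "\<And>t. (f has_vector_derivative g t) (at t)"
  shows "continuous_on S f"
  using has_vector_derivative_continuous[OF assms] by (simp add: continuous_at_imp_continuous_on)

lemma vector_derivative_unique_primitive:
  fixes f :: "real \<Rightarrow> 'a::real_normed_vector"
  assumes "\<And>t. (f has_vector_derivative k t) (at t)" "\<And>t. (g has_vector_derivative k t) (at t)"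
    and "f a = g a"
  shows "f t = g t"
proof -
  have "((\<lambda>t. f t - g t) has_derivative (\<lambda>h. 0)) (at s)" for s
    using has_vector_derivative_diff[OF assms(1,2)] by (simp add: has_vector_derivative_def)
  from has_derivative_zero_unique[of UNIV "\<lambda>t. f t - g t", OF convex_UNIV this, of t a]
  show ?thesis using assms(3) by simp
qed

text \<open>One integration turns the power n into n + 1 and divides by n + 1, so repeated use
  produces the factorials that make Picard iteration converge. Positive times follow from the mean
  value inequality, negative ones by reflecting \<open>f\<close>.\<close>

lemma norm_le_of_derivative_growth:
  fixes f :: "real \<Rightarrow> 'a::real_normed_vector"
  assumes f: "\<And>t. (f has_vector_derivative g t) (at t)" "f 0 = 0"
    and g: "\<And>s. \<bar>s\<bar> \<le> b \<Longrightarrow> norm (g s) \<le> K * \<bar>s\<bar> ^ n"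
    and t: "\<bar>t\<bar> \<le> b"
  shows "norm (f t) \<le> K * \<bar>t\<bar> ^ Suc n / Suc n"
proof -
  have pos: "norm (f t) \<le> K * \<bar>t\<bar> ^ Suc n / Suc n"
    if f: "\<And>t. (f has_vector_derivative g t) (at t)" "f 0 = 0"
      and g: "\<And>s. \<bar>s\<bar> \<le> b \<Longrightarrow> norm (g s) \<le> K * \<bar>s\<bar> ^ n"
      and t: "0 < t" "t \<le> b" for f g :: "real \<Rightarrow> 'a" and t
  proof -
    have "norm (f t - f 0) \<le> K * t ^ Suc n / Suc n - K * 0 ^ Suc n / Suc n"
    proof (rule differentiable_bound_general[where f' = g and \<phi>' = "\<lambda>s. K * s ^ n"])
      show "continuous_on {0..t} f" using f(1) by (rule vector_derivative_continuous_on)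
      show "((\<lambda>s. K * s ^ Suc n / Suc n) has_vector_derivative K * s ^ n) (at s)" for s :: real
        unfolding has_real_derivative_iff_has_vector_derivative[symmetric]
        by (auto intro!: derivative_eq_intros simp del: power_Suc of_nat_Suc)
      show "norm (g s) \<le> K * s ^ n" if "0 < s" "s < t" for s using g[of s] that t by simp
    qed (use t f in \<open>auto intro!: continuous_intros\<close>)
    then show ?thesis using f t by simp
  qed
  consider "t = 0" | "0 < t" | "0 < - t" by linarith
  then show ?thesis
  proof cases
    case 3
    have "((\<lambda>t. f (- t)) has_vector_derivative - g (- t)) (at t)" for t
    proof -
      have "(uminus has_vector_derivative - 1) (at t)" by (auto intro!: derivative_eq_intros)
      from vector_diff_chain_at[OF this f(1)] show ?thesis by (simp add: o_def)
    qed
    moreover have "norm (- g (- s)) \<le> K * \<bar>s\<bar> ^ n" if "\<bar>s\<bar> \<le> b" for s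
      using g[of "- s"] that by simp
    ultimately show ?thesis using pos[of "\<lambda>t. f (- t)" "\<lambda>t. - g (- t)" "- t"] f t 3 by simp
  qed (use pos[OF f g] t f in auto)
qed

section \<open>Linear evolution equations\<close>

text \<open>Continuity is required for each fixed \<open>x\<close> and not in operator norm, since a
  group with an unbounded generator is not norm continuous.\<close>

definition strongly_continuous :: "(real \<Rightarrow> 'a::banach \<Rightarrow> 'b::real_normed_vector) \<Rightarrow> bool"
  where "strongly_continuous Q \<longleftrightarrow>
    (\<forall>t. bounded_linear (Q t)) \<and> (\<forall>x. continuous_on UNIV (\<lambda>t. Q t x))"

text \<open>Each orbit is bounded on the compact time interval; uniform boundedness makes the bound
  independent of the starting vector.\<close>

lemma strongly_continuous_bounded:
  assumes Q: "strongly_continuous Q"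
  obtains C where "C \<ge> 0" "\<And>t x. \<bar>t\<bar> \<le> b \<Longrightarrow> norm (Q t x) \<le> C * norm x"
proof -
  have "\<exists>K. \<forall>t\<in>{-b..b}. norm (Q t x) \<le> K" for x
  proof -
    have "continuous_on {-b..b} (\<lambda>t. Q t x)"
      using Q unfolding strongly_continuous_def by (auto intro: continuous_on_subset)
    from compact_imp_bounded[OF compact_continuous_image[OF this compact_Icc]]
    show ?thesis by (auto simp: bounded_iff)
  qed
  from uniform_boundedness[of "{-b..b}" Q, OF _ this] Q
  obtain C where "C \<ge> 0" "\<forall>t\<in>{-b..b}. \<forall>x. norm (Q t x) \<le> C * norm x"
    unfolding strongly_continuous_def by blast
  then show ?thesis by (intro that[of C]) (auto simp: abs_le_iff)
qed

text \<open>Joint continuity: the local uniform bound controls \<open>Q s (y s - z)\<close>, strong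
  continuity controls \<open>Q s z\<close>.\<close>

lemma strongly_continuous_tendsto:
  assumes Q: "strongly_continuous Q" and y: "(y \<longlongrightarrow> z) (at t)"
  shows "((\<lambda>s. Q s (y s)) \<longlongrightarrow> Q t z) (at t)"
proof -
  interpret Q: bounded_linear "Q s" for s using Q by (simp add: strongly_continuous_def)
  obtain C where C: "C \<ge> 0" "\<And>s x. \<bar>s\<bar> \<le> \<bar>t\<bar> + 1 \<Longrightarrow> norm (Q s x) \<le> C * norm x"
    using strongly_continuous_bounded[OF Q] by blast
  have "((\<lambda>s. C * norm (y s - z)) \<longlongrightarrow> C * norm (z - z)) (at t)"
    by (intro tendsto_intros y)
  moreover have "\<forall>\<^sub>F s in at t. norm (Q s (y s - z)) \<le> C * norm (y s - z)"
    unfolding eventually_at by (rule exI[of _ 1]) (auto simp: dist_norm intro!: C(2))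
  ultimately have "((\<lambda>s. Q s (y s - z)) \<longlongrightarrow> 0) (at t)"
    by (auto intro: Lim_null_comparison)
  moreover have "((\<lambda>s. Q s z) \<longlongrightarrow> Q t z) (at t)"
    using Q by (auto simp: strongly_continuous_def continuous_on_def)
  ultimately have "((\<lambda>s. Q s (y s - z) + Q s z) \<longlongrightarrow> 0 + Q t z) (at t)"
    by (rule tendsto_add)
  then show ?thesis by (simp add: Q.diff)
qed

lemma strongly_continuous_apply:
  assumes "strongly_continuous Q" "continuous_on UNIV y"
  shows "continuous_on UNIV (\<lambda>t. Q t (y t))"
  using assms(2) by (simp add: continuous_on_def strongly_continuous_tendsto[OF assms(1)])

text \<open>A Gronwall argument by iteration: feeding a bound on the difference \<open>d\<close>
  back into its own equation n times leaves K (C |t|)^n / n!, the general term of an exponential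
  series, which tends to 0.\<close>

lemma evolution_unique:
  fixes y z :: "real \<Rightarrow> 'a::banach"
  assumes Q: "strongly_continuous Q"
    and y: "\<And>t. (y has_vector_derivative Q t (y t)) (at t)"
    and z: "\<And>t. (z has_vector_derivative Q t (z t)) (at t)"
    and eq: "y 0 = z 0"
  shows "y t = z t"
proof -
  interpret Q: bounded_linear "Q s" for s using Q by (simp add: strongly_continuous_def)
  define d where "d s = y s - z s" for s
  have d: "(d has_vector_derivative Q s (d s)) (at s)" for s
    using has_vector_derivative_diff[OF y z] by (simp add: d_def[abs_def] Q.diff)
  obtain C where C: "C \<ge> 0" "\<And>s x. \<bar>s\<bar> \<le> \<bar>t\<bar> \<Longrightarrow> norm (Q s x) \<le> C * norm x"
    using strongly_continuous_bounded[OF Q] by blast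
  have "compact (d ` {-\<bar>t\<bar>..\<bar>t\<bar>})"
    using d by (intro compact_continuous_image vector_derivative_continuous_on) auto
  then obtain K where K: "\<And>s. \<bar>s\<bar> \<le> \<bar>t\<bar> \<Longrightarrow> norm (d s) \<le> K"
    by (force dest!: compact_imp_bounded simp: bounded_iff)
  have bound: "norm (d s) \<le> K * C ^ n / fact n * \<bar>s\<bar> ^ n" if "\<bar>s\<bar> \<le> \<bar>t\<bar>" for n s
    using that
  proof (induction n arbitrary: s)
    case 0
    then show ?case using K by simp
  next
    case (Suc n)
    have "norm (d s) \<le> (K * C ^ Suc n / fact n) * \<bar>s\<bar> ^ Suc n / Suc n"
    proof (rule norm_le_of_derivative_growth[OF d])
      show "norm (Q r (d r)) \<le> K * C ^ Suc n / fact n * \<bar>r\<bar> ^ n" if "\<bar>r\<bar> \<le> \<bar>t\<bar>" for r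
        using order_trans[OF C(2)[OF that] mult_left_mono[OF Suc.IH[OF that] C(1)]]
        by (simp add: mult_ac)
    qed (use Suc.prems in \<open>auto simp: d_def eq\<close>)
    then show ?case by (simp add: field_simps)
  qed
  have "(\<lambda>n. K * (inverse (fact n) * (C * \<bar>t\<bar>) ^ n)) \<longlonglongrightarrow> K * 0"
    by (intro tendsto_mult_left summable_LIMSEQ_zero summable_exp)
  moreover have "norm (d t) \<le> K * (inverse (fact n) * (C * \<bar>t\<bar>) ^ n)" for n
    using bound[of t n] by (simp add: field_simps power_mult_distrib)
  ultimately have "norm (d t) \<le> 0" by (intro LIMSEQ_le_const) auto
  then show ?thesis by (simp add: d_def)
qed

text \<open>The solution is the sum of the Picard series. The final clause, linear in the norm of
  \<open>x\<close> and valid for every window \<open>b\<close> with the same \<open>y\<close>, is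
  what later makes the solution depend boundedly on its initial value.\<close>

lemma evolution_exists:
  fixes Q :: "real \<Rightarrow> 'a::banach \<Rightarrow> 'a"
  assumes Q: "strongly_continuous Q"
  shows "\<exists>y. y 0 = x \<and> (\<forall>t. (y has_vector_derivative Q t (y t)) (at t)) \<and>
    (\<forall>b C. C \<ge> 0 \<longrightarrow> (\<forall>t z. \<bar>t\<bar> \<le> b \<longrightarrow> norm (Q t z) \<le> C * norm z) \<longrightarrow>
      (\<forall>t. \<bar>t\<bar> \<le> b \<longrightarrow> norm (y t) \<le> exp (C * b) * norm x))"
proof -
  interpret Q: bounded_linear "Q s" for s using Q by (simp add: strongly_continuous_def)
  \<comment> \<open>\<open>p n\<close> is the n-th term of the series, not the n-th Picard iterate;
    the iterates are the partial sums.\<close>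
  define p where "p = rec_nat (\<lambda>t. x) (\<lambda>_ q. primitive (\<lambda>t. Q t (q t)))"
  have p0: "p 0 = (\<lambda>t. x)" and pS: "p (Suc n) = primitive (\<lambda>t. Q t (p n t))" for n
    by (simp_all add: p_def)
  have cont: "continuous_on UNIV (p n)" for n
  proof (induction n)
    case (Suc n)
    show ?case unfolding pS
      by (rule vector_derivative_continuous_on, rule primitive_deriv,
          rule strongly_continuous_apply[OF Q Suc])
  qed (simp add: p0)
  have Qp: "continuous_on UNIV (\<lambda>t. Q t (p n t))" for n
    by (rule strongly_continuous_apply[OF Q cont])
  define p' where "p' n t = (case n of 0 \<Rightarrow> 0 | Suc m \<Rightarrow> Q t (p m t))" for n t
  have p': "(p n has_vector_derivative p' n t) (at t)" for n t
    by (cases n) (auto simp: p0 pS p'_def intro: primitive_deriv[OF Qp])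
  have p_init: "p n 0 = (if n = 0 then x else 0)" for n
    by (cases n) (auto simp: p0 pS primitive_0[OF Qp])
  have bound: "norm (p n t) \<le> norm x * C ^ n / fact n * \<bar>t\<bar> ^ n"
    if C: "C \<ge> 0" "\<And>t z. \<bar>t\<bar> \<le> b \<Longrightarrow> norm (Q t z) \<le> C * norm z" and t: "\<bar>t\<bar> \<le> b" for C b t n
    using t
  proof (induction n arbitrary: t)
    case 0
    then show ?case by (simp add: p0)
  next
    case (Suc n)
    have "norm (p (Suc n) t) \<le> (norm x * C ^ Suc n / fact n) * \<bar>t\<bar> ^ Suc n / Suc n"
    proof (rule norm_le_of_derivative_growth[OF p'])
      show "norm (p' (Suc n) r) \<le> norm x * C ^ Suc n / fact n * \<bar>r\<bar> ^ n" if "\<bar>r\<bar> \<le> b" for r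
        using order_trans[OF C(2)[OF that] mult_left_mono[OF Suc.IH[OF that] C(1)]]
        by (simp add: mult_ac p'_def)
    qed (use Suc.prems in \<open>auto simp: p_init\<close>)
    then show ?case by (simp add: field_simps)
  qed
  have bound': "norm (p n t) \<le> norm x * (inverse (fact n) * (C * b) ^ n)"
    if C: "C \<ge> 0" "\<And>t z. \<bar>t\<bar> \<le> b \<Longrightarrow> norm (Q t z) \<le> C * norm z" and t: "\<bar>t\<bar> \<le> b" for C b t n
  proof -
    have "norm x * C ^ n / fact n * \<bar>t\<bar> ^ n \<le> norm x * C ^ n / fact n * b ^ n"
      using t C by (intro mult_left_mono power_mono) auto
    also have "\<dots> = norm x * (inverse (fact n) * (C * b) ^ n)"
      by (simp add: power_mult_distrib divide_inverse mult_ac)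
    finally show ?thesis using bound[OF C t, of n] by linarith
  qed
  define y where "y t = (\<Sum>n. p n t)" for t
  have sums_p: "(\<lambda>n. p n t) sums y t" and norm_y: "norm (y t) \<le> exp (C * b) * norm x"
    if C: "C \<ge> 0" "\<And>t z. \<bar>t\<bar> \<le> b \<Longrightarrow> norm (Q t z) \<le> C * norm z" and t: "\<bar>t\<bar> \<le> b" for C b t
  proof -
    have sm: "summable (\<lambda>n. norm x * (inverse (fact n) * (C * b) ^ n))"
      by (intro summable_mult summable_exp)
    then have sn: "summable (\<lambda>n. norm (p n t))"
      by (rule summable_comparison_test_ev[rotated]) (simp add: bound'[OF that])
    show "(\<lambda>n. p n t) sums y t"
      unfolding y_def by (rule summable_sums[OF summable_norm_cancel[OF sn]])
    have "norm (y t) \<le> (\<Sum>n. norm (p n t))"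
      unfolding y_def by (rule summable_norm[OF sn])
    also have "\<dots> \<le> (\<Sum>n. norm x * (inverse (fact n) * (C * b) ^ n))"
      by (rule suminf_le[OF bound'[OF that] sn sm])
    also have "\<dots> = exp (C * b) * norm x"
      by (subst suminf_mult[OF summable_exp]) (simp add: exp_def divide_inverse mult_ac)
    finally show "norm (y t) \<le> exp (C * b) * norm x" .
  qed
  have y_deriv: "(y has_vector_derivative Q t (y t)) (at t)" for t
  proof -
    define b where "b = \<bar>t\<bar> + 1"
    obtain C where C: "C \<ge> 0" "\<And>s z. \<bar>s\<bar> \<le> b \<Longrightarrow> norm (Q s z) \<le> C * norm z"
      using strongly_continuous_bounded[OF Q] by blast
    have "uniform_limit {-b..b} (\<lambda>n s. \<Sum>i<n. p i s) (\<lambda>s. \<Sum>i. p i s) sequentially"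
      by (rule Weierstrass_m_test[OF bound'[OF C]])
        (auto intro!: summable_mult summable_exp)
    then have ul: "uniform_limit {-b..b} (\<lambda>n s. \<Sum>i<n. p i s) y sequentially"
      by (simp add: y_def[abs_def])
    \<comment> \<open>The shift by one arises because the term of index 0 is constant and each later
      term has as derivative \<open>Q\<close> applied to its predecessor. For \<open>n = 0\<close>
      both sums are empty.\<close>
    have sum_p': "(\<Sum>i<n. p' i s) = Q s (\<Sum>i<n - 1. p i s)" for n s
    proof (cases n)
      case (Suc m)
      show ?thesis unfolding Suc sum.lessThan_Suc_shift by (simp add: p'_def Q.sum)
    qed (simp add: Q.zero)
    have "\<exists>g. \<forall>s\<in>{-b..b}. (\<lambda>n. p n s) sums (g s) \<and>
      (g has_derivative (\<lambda>h. h *\<^sub>R Q s (y s))) (at s within {-b..b})"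
    proof (rule has_derivative_series[where f' = "\<lambda>n s h. h *\<^sub>R p' n s" and x = 0])
      show "(p n has_derivative (\<lambda>h. h *\<^sub>R p' n s)) (at s within {-b..b})" for n s
        using p'[of n s] unfolding has_vector_derivative_def by (rule has_derivative_at_withinI)
      show "\<forall>\<^sub>F n in sequentially. \<forall>s\<in>{-b..b}. \<forall>h.
          norm ((\<Sum>i<n. h *\<^sub>R p' i s) - h *\<^sub>R Q s (y s)) \<le> e * norm h" if e: "e > 0" for e
      proof -
        \<comment> \<open>Dividing by \<open>C + 1\<close> instead of \<open>C\<close> covers the
          case \<open>C = 0\<close>.\<close>
        have "e / (C + 1) > 0" using e C by simp
        from uniform_limitD[OF ul this]
        have "\<forall>\<^sub>F n in sequentially. \<forall>s\<in>{-b..b}. dist (\<Sum>i<n - 1. p i s) (y s) < e / (C + 1)"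
          by (rule eventually_compose_filterlim) (rule filterlim_minus_const_nat_at_top)
        then show ?thesis
        proof (rule eventually_mono, intro ballI allI)
          fix n s h
          assume "\<forall>s\<in>{-b..b}. dist (\<Sum>i<n - 1. p i s) (y s) < e / (C + 1)" "s \<in> {-b..b}"
          then have "norm ((\<Sum>i<n - 1. p i s) - y s) \<le> e / (C + 1)" and s: "\<bar>s\<bar> \<le> b"
            by (auto simp: dist_norm less_imp_le)
          then have "norm (Q s ((\<Sum>i<n - 1. p i s) - y s)) \<le> C * (e / (C + 1))"
            using C(1) by (intro order_trans[OF C(2)[OF s]] mult_left_mono)
          also have "\<dots> \<le> e" using C(1) e by (simp add: field_simps)
          finally have "\<bar>h\<bar> * norm (Q s ((\<Sum>i<n - 1. p i s) - y s)) \<le> \<bar>h\<bar> * e"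
            by (intro mult_left_mono) auto
          moreover have "(\<Sum>i<n. h *\<^sub>R p' i s) - h *\<^sub>R Q s (y s) =
              h *\<^sub>R Q s ((\<Sum>i<n - 1. p i s) - y s)"
            by (simp add: scaleR_sum_right[symmetric] sum_p' Q.diff scaleR_diff_right)
          ultimately show "norm ((\<Sum>i<n. h *\<^sub>R p' i s) - h *\<^sub>R Q s (y s)) \<le> e * norm h"
            by (simp add: mult.commute)
        qed
      qed
      show "(\<lambda>n. p n 0) sums y 0" by (rule sums_p[OF C]) (auto simp: b_def)
    qed (auto simp: b_def)
    then obtain g where g: "\<forall>s\<in>{-b..b}. (\<lambda>n. p n s) sums (g s) \<and>
      (g has_derivative (\<lambda>h. h *\<^sub>R Q s (y s))) (at s within {-b..b})"
      by (rule exE)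
    have g_eq: "g s = y s" if "s \<in> {-b..b}" for s
    proof (rule sums_unique2)
      show "(\<lambda>n. p n s) sums g s" using g that by simp
      show "(\<lambda>n. p n s) sums y s" using that by (intro sums_p[OF C]) auto
    qed
    have t: "t \<in> {-b<..<b}" by (auto simp: b_def)
    then have "(g has_vector_derivative Q t (y t)) (at t within {-b..b})"
      using g by (simp add: has_vector_derivative_def)
    then have "(g has_vector_derivative Q t (y t)) (at t)"
      using t by (subst (asm) at_within_interior) auto
    then show ?thesis
      by (rule has_vector_derivative_transform_within_open[OF _ _ t]) (auto intro: g_eq)
  qed
  have y_0: "y 0 = x"
  proof -
    have "(\<lambda>n. p n 0) = (\<lambda>n. if n = 0 then x else 0)" by (auto simp: p_init)
    then have "(\<lambda>n. p n 0) sums x" using sums_single[of 0 "\<lambda>_. x"] by simp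
    then show ?thesis by (simp add: y_def sums_iff)
  qed
  show ?thesis
  proof (intro exI[of _ y] conjI allI impI y_0 y_deriv)
    show "norm (y t) \<le> exp (C * b) * norm x"
      if "C \<ge> 0" "\<forall>t z. \<bar>t\<bar> \<le> b \<longrightarrow> norm (Q t z) \<le> C * norm z" "\<bar>t\<bar> \<le> b" for b C t
      by (rule norm_y) (use that in blast)+
  qed
qed

text \<open>Bridge between the difference quotients that define a generator and the derivative
  calculus used for everything else.\<close>

lemma has_vector_derivative_iff_quotient:
  fixes f :: "real \<Rightarrow> 'a::real_normed_vector"
  shows "(f has_vector_derivative y) (at 0) \<longleftrightarrow> ((\<lambda>h. (1 / h) *\<^sub>R (f h - f 0)) \<longlongrightarrow> y) (at 0)"
proof -
  have eq: "norm (f h - f 0 - h *\<^sub>R y) / norm h = norm ((1 / h) *\<^sub>R (f h - f 0) - y)"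
    if "h \<noteq> 0" for h
  proof -
    have "(1 / h) *\<^sub>R (f h - f 0) - y = (1 / h) *\<^sub>R (f h - f 0 - h *\<^sub>R y)"
      using that by (simp add: scaleR_diff_right)
    then show ?thesis by simp
  qed
  have "(f has_vector_derivative y) (at 0) \<longleftrightarrow>
      ((\<lambda>h. norm (f h - f 0 - h *\<^sub>R y) / norm h) \<longlongrightarrow> 0) (at 0)"
    by (simp add: has_vector_derivative_def has_derivative_at bounded_linear_scaleR_left)
  also have "\<dots> \<longleftrightarrow> ((\<lambda>h. norm ((1 / h) *\<^sub>R (f h - f 0) - y)) \<longlongrightarrow> 0) (at 0)"
    by (rule Lim_cong_within) (auto simp: eq simp del: real_norm_def)
  also have "\<dots> \<longleftrightarrow> ((\<lambda>h. (1 / h) *\<^sub>R (f h - f 0)) \<longlongrightarrow> y) (at 0)"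
    by (simp only: tendsto_norm_zero_iff LIM_zero_iff)
  finally show ?thesis .
qed

lemma strongly_continuous_const: "bounded_linear L \<Longrightarrow> strongly_continuous (\<lambda>t. L)"
  by (simp add: strongly_continuous_def)

lemma strongly_continuous_compose:
  assumes "strongly_continuous P" "strongly_continuous Q"
  shows "strongly_continuous (\<lambda>t x. P t (Q t x))"
  unfolding strongly_continuous_def
proof (intro conjI allI)
  show "bounded_linear (\<lambda>x. P t (Q t x))" for t
    using assms by (auto simp: strongly_continuous_def intro: bounded_linear_compose)
  show "continuous_on UNIV (\<lambda>t. P t (Q t x))" for x
    by (rule strongly_continuous_apply[OF assms(1)]) (use assms(2) in \<open>simp add: strongly_continuous_def\<close>)
qed

section \<open>Strongly continuous groups and their generators\<close>

text \<open>Only real scalars appear, so that the same theory serves the product of two complex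
  spaces. The equivalence in \<open>generator\<close> fixes the domain as well as the
  values.\<close>

locale group_generator =
  fixes U :: "real \<Rightarrow> 'a::banach \<Rightarrow> 'a" and D :: "'a set" and T :: "'a \<Rightarrow> 'a"
  assumes strongly_continuous: "strongly_continuous U"
    and zero: "U 0 x = x"
    and add: "U (s + t) x = U s (U t x)"
    and generator: "((\<lambda>t. U t x) has_vector_derivative y) (at 0) \<longleftrightarrow> x \<in> D \<and> T x = y"
begin

lemma bounded_linear: "bounded_linear (U t)"
  using strongly_continuous by (simp add: strongly_continuous_def)

lemmas U_linear = linear_simps[OF bounded_linear]

lemma continuous_orbit: "continuous_on S (\<lambda>t. U t x)"
  using strongly_continuous continuous_on_subset[of UNIV "\<lambda>t. U t x" S]
  by (simp add: strongly_continuous_def)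

lemma strongly_continuous_uminus: "strongly_continuous (\<lambda>t. U (- t))"
  unfolding strongly_continuous_def
proof (intro conjI allI bounded_linear)
  show "continuous_on UNIV (\<lambda>t. U (- t) x)" for x
    by (rule continuous_on_compose2[OF continuous_orbit[of UNIV]]) (auto intro: continuous_intros)
qed

lemma orbit_derivative:
  assumes "x \<in> D"
  shows "((\<lambda>t. U t x) has_vector_derivative U t (T x)) (at t)"
proof -
  have "((\<lambda>s. s - t) has_vector_derivative 1) (at t)"
    by (auto intro!: derivative_eq_intros)
  moreover have "((\<lambda>s. U s x) has_vector_derivative T x) (at (t - t))"
    using generator[of x "T x"] assms by simp
  ultimately have "((\<lambda>s. U (s - t) x) has_vector_derivative T x) (at t)"
    using vector_diff_chain_at[of "\<lambda>s. s - t" 1 t "\<lambda>s. U s x"] by (simp add: o_def)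
  from bounded_linear.has_vector_derivative[OF bounded_linear[of t] this]
  show ?thesis by (simp add: add[symmetric])
qed

text \<open>A bounded map that commutes with the group can be applied to the difference quotient.
  Scalar multiplications in the role of \<open>L\<close> yield the homogeneity of \<open>T\<close>,
  first over the reals and later over the complex numbers.\<close>

lemma commuting_operator:
  assumes L: "bounded_linear L" "\<And>t x. L (U t x) = U t (L x)" and x: "x \<in> D"
  shows "L x \<in> D" "T (L x) = L (T x)"
proof -
  have "((\<lambda>t. L (U t x)) has_vector_derivative L (T x)) (at 0)"
    using generator[of x "T x"] x by (intro bounded_linear.has_vector_derivative[OF L(1)]) simp
  then show "L x \<in> D" "T (L x) = L (T x)" using generator by (auto simp: L(2))
qed

lemma domain_add:
  assumes "x \<in> D" "y \<in> D"
  shows "x + y \<in> D" "T (x + y) = T x + T y"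
proof -
  have "((\<lambda>t. U t x + U t y) has_vector_derivative T x + T y) (at 0)"
    using assms by (intro has_vector_derivative_add) (simp_all add: generator)
  then have "((\<lambda>t. U t (x + y)) has_vector_derivative T x + T y) (at 0)" by (simp add: U_linear)
  then show "x + y \<in> D" "T (x + y) = T x + T y" by (simp_all add: generator)
qed

lemma domain_scaleR:
  assumes "x \<in> D"
  shows "c *\<^sub>R x \<in> D" "T (c *\<^sub>R x) = c *\<^sub>R T x"
  using commuting_operator[of "\<lambda>x. c *\<^sub>R x", OF bounded_linear_scaleR_right _ assms]
  by (simp_all add: U_linear)

lemma domain_diff:
  assumes "x \<in> D" "y \<in> D"
  shows "x - y \<in> D" "T (x - y) = T x - T y"
  using domain_add[OF assms(1) domain_scaleR(1)[OF assms(2), of "- 1"]]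
    domain_scaleR(2)[OF assms(2), of "- 1"] by simp_all

text \<open>A sufficiently negative \<open>c\<close> turns the time-one map into a strict
  contraction, which is how a resolvent point is found. The two implications are symmetric: the
  factor is undone by \<open>exp (- c * t)\<close>.\<close>

lemma rescale: "group_generator (\<lambda>t x. exp (c * t) *\<^sub>R U t x) D (\<lambda>x. T x + c *\<^sub>R x)"
proof
  show "strongly_continuous (\<lambda>t x. exp (c * t) *\<^sub>R U t x)"
    unfolding strongly_continuous_def
    by (intro conjI allI bounded_linear_scaleR_right[THEN bounded_linear_compose] bounded_linear
        continuous_intros continuous_orbit)
  show "((\<lambda>t. exp (c * t) *\<^sub>R U t x) has_vector_derivative y) (at 0) \<longleftrightarrow> x \<in> D \<and> T x + c *\<^sub>R x = y"
    for x y
  proof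
    assume "((\<lambda>t. exp (c * t) *\<^sub>R U t x) has_vector_derivative y) (at 0)"
    moreover have "((\<lambda>t. exp (- c * t)) has_real_derivative - c) (at 0)"
      by (auto intro!: derivative_eq_intros)
    ultimately have "((\<lambda>t. exp (- c * t) *\<^sub>R exp (c * t) *\<^sub>R U t x) has_vector_derivative
        exp (- c * 0) *\<^sub>R y + (- c) *\<^sub>R exp (c * 0) *\<^sub>R U 0 x) (at 0)"
      by (intro has_vector_derivative_scaleR)
    then have "((\<lambda>t. U t x) has_vector_derivative y - c *\<^sub>R x) (at 0)"
      by (simp add: zero mult_exp_exp)
    then show "x \<in> D \<and> T x + c *\<^sub>R x = y" by (simp add: generator)
  next
    assume "x \<in> D \<and> T x + c *\<^sub>R x = y"
    then have "((\<lambda>t. U t x) has_vector_derivative y - c *\<^sub>R x) (at 0)" by (auto simp: generator)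
    moreover have "((\<lambda>t. exp (c * t)) has_real_derivative c) (at 0)"
      by (auto intro!: derivative_eq_intros)
    ultimately have "((\<lambda>t. exp (c * t) *\<^sub>R U t x) has_vector_derivative
        exp (c * 0) *\<^sub>R (y - c *\<^sub>R x) + c *\<^sub>R U 0 x) (at 0)"
      by (intro has_vector_derivative_scaleR)
    then show "((\<lambda>t. exp (c * t) *\<^sub>R U t x) has_vector_derivative y) (at 0)"
      by (simp add: zero)
  qed
qed (auto simp: zero add U_linear distrib_left exp_add)

text \<open>
  The perturbed group is sought in the form \<open>S t = U t \<circ> V t\<close>.  Then \<open>V\<close> solves
  \<open>V' t = U (- t) P (U t) V t\<close>, whose coefficients are bounded although \<open>T\<close> is not.
\<close>

lemma perturbation:
  assumes P: "bounded_linear P"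
  shows "\<exists>S. group_generator S D (\<lambda>x. T x + P x) \<and>
    (\<forall>L. bounded_linear L \<longrightarrow> (\<forall>t x. L (U t x) = U t (L x)) \<longrightarrow> (\<forall>x. L (P x) = P (L x)) \<longrightarrow>
      (\<forall>t x. L (S t x) = S t (L x)))"
proof -
  interpret P: bounded_linear P by (rule P)
  define Q where "Q t x = U (- t) (P (U t x))" for t x
  have Q: "strongly_continuous Q"
    unfolding Q_def[abs_def]
    by (rule strongly_continuous_compose[OF strongly_continuous_uminus
          strongly_continuous_compose[OF strongly_continuous_const[OF P] strongly_continuous]])
  have Q_lin: "bounded_linear (Q t)" for t
    using Q by (simp add: strongly_continuous_def)
  obtain v where v0: "\<And>x. v x 0 = x"
    and v: "\<And>x t. (v x has_vector_derivative Q t (v x t)) (at t)"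
    and v_bound: "\<And>x b C. C \<ge> 0 \<Longrightarrow> \<forall>t z. \<bar>t\<bar> \<le> b \<longrightarrow> norm (Q t z) \<le> C * norm z \<Longrightarrow>
      \<forall>t. \<bar>t\<bar> \<le> b \<longrightarrow> norm (v x t) \<le> exp (C * b) * norm x"
    using evolution_exists[OF Q] by metis
  have v_unique: "v x t = z t"
    if "\<And>t. (z has_vector_derivative Q t (z t)) (at t)" "z 0 = x" for x z t
    by (rule evolution_unique[OF Q v that(1)]) (simp add: v0 that)
  have v_lin: "bounded_linear (\<lambda>x. v x t)" for t
  proof -
    obtain C where C: "C \<ge> 0" "\<And>s x. \<bar>s\<bar> \<le> \<bar>t\<bar> \<Longrightarrow> norm (Q s x) \<le> C * norm x"
      using strongly_continuous_bounded[OF Q] by blast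
    show ?thesis
    proof (rule bounded_linear_intro)
      show "v (x + y) t = v x t + v y t" for x y
        by (rule v_unique)
          (auto simp: v0 linear_simps[OF Q_lin] intro!: has_vector_derivative_add v)
      show "v (c *\<^sub>R x) t = c *\<^sub>R v x t" for c x
        by (rule v_unique)
          (auto simp: v0 linear_simps[OF Q_lin]
            intro!: bounded_linear.has_vector_derivative[OF bounded_linear_scaleR_right] v)
      show "norm (v x t) \<le> norm x * exp (C * \<bar>t\<bar>)" for x
        using v_bound[OF C(1), of "\<bar>t\<bar>" x] C(2) by (simp add: mult.commute)
    qed
  qed
  define S where "S t x = U t (v x t)" for t x
  \<comment> \<open>The group law of \<open>S\<close> comes from uniqueness: the right-hand side, as
    a function of \<open>t\<close>, solves the equation of \<open>v\<close> with initial value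
    \<open>S s x\<close>, because the conjugating factors in \<open>Q\<close> absorb the time
    shift.\<close>
  have S_cocycle: "v (S s x) t = U s (v x (t + s))" for s t x
  proof (rule v_unique)
    fix t
    have "((\<lambda>t. t + s) has_vector_derivative 1) (at t)"
      by (auto intro!: derivative_eq_intros)
    from vector_diff_chain_at[OF this v[of x "t + s"]]
    have "((\<lambda>t. v x (t + s)) has_vector_derivative Q (t + s) (v x (t + s))) (at t)"
      by (simp add: o_def)
    from bounded_linear.has_vector_derivative[OF bounded_linear[of s] this]
    show "((\<lambda>t. U s (v x (t + s))) has_vector_derivative Q t (U s (v x (t + s)))) (at t)"
      by (simp add: Q_def add[symmetric])
  qed (simp add: S_def)
  \<comment> \<open>This limit exists for every \<open>x\<close>, not only on \<open>D\<close>.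
    Hence the orbits of \<open>x\<close> under \<open>S\<close> and \<open>U\<close> are
    differentiable at 0 for the same \<open>x\<close>, and the domain is unchanged.\<close>
  have quotient: "((\<lambda>h. (1 / h) *\<^sub>R (S h x - U h x)) \<longlongrightarrow> P x) (at 0)" for x
  proof -
    have "((\<lambda>h. (1 / h) *\<^sub>R (v x h - v x 0)) \<longlongrightarrow> P x) (at 0)"
      using v[of x 0] unfolding has_vector_derivative_iff_quotient by (simp add: v0 Q_def zero)
    from strongly_continuous_tendsto[OF strongly_continuous this]
    show ?thesis by (simp add: S_def zero v0 U_linear)
  qed
  have "group_generator S D (\<lambda>x. T x + P x)"
  proof
    show "strongly_continuous S"
      unfolding strongly_continuous_def
    proof (intro conjI allI)
      show "bounded_linear (S t)" for t
        unfolding S_def by (rule bounded_linear_compose[OF bounded_linear v_lin])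
      show "continuous_on UNIV (\<lambda>t. S t x)" for x
        unfolding S_def
        by (rule strongly_continuous_apply[OF strongly_continuous vector_derivative_continuous_on[OF v]])
    qed
    show "S 0 x = x" for x by (simp add: S_def zero v0)
    show "S (s + t) x = S s (S t x)" for s t x
      unfolding S_def[of "s + t"] S_def[of s] S_cocycle by (simp add: add)
    show "((\<lambda>t. S t x) has_vector_derivative y) (at 0) \<longleftrightarrow> x \<in> D \<and> T x + P x = y" for x y
    proof -
      have eq: "(1 / h) *\<^sub>R (S h x - x) = (1 / h) *\<^sub>R (U h x - x) + (1 / h) *\<^sub>R (S h x - U h x)" for h
        by (simp add: scaleR_add_right[symmetric])
      have "((\<lambda>t. S t x) has_vector_derivative y) (at 0) \<longleftrightarrow>
          ((\<lambda>t. U t x) has_vector_derivative y - P x) (at 0)"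
        unfolding has_vector_derivative_iff_quotient
      proof
        assume "((\<lambda>h. (1 / h) *\<^sub>R (S h x - S 0 x)) \<longlongrightarrow> y) (at 0)"
        from tendsto_diff[OF this quotient[of x]]
        show "((\<lambda>h. (1 / h) *\<^sub>R (U h x - U 0 x)) \<longlongrightarrow> y - P x) (at 0)"
          by (simp add: S_def[of 0] zero v0 eq)
      next
        assume "((\<lambda>h. (1 / h) *\<^sub>R (U h x - U 0 x)) \<longlongrightarrow> y - P x) (at 0)"
        from tendsto_add[OF this quotient[of x]]
        show "((\<lambda>h. (1 / h) *\<^sub>R (S h x - S 0 x)) \<longlongrightarrow> y) (at 0)"
          by (simp add: S_def[of 0] zero v0 eq)
      qed
      then show ?thesis by (auto simp: generator)
    qed
  qed
  \<comment> \<open>Both sides of the equation for \<open>v\<close> solve the same initial value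
    problem. With \<open>L\<close> a complex scalar multiplication this keeps the perturbed group
    complex linear.\<close>
  moreover have "L (S t x) = S t (L x)"
    if L: "bounded_linear L" "\<And>t x. L (U t x) = U t (L x)" "\<And>x. L (P x) = P (L x)" for L t x
  proof -
    have "v (L x) t = L (v x t)"
    proof (rule v_unique)
      show "((\<lambda>t. L (v x t)) has_vector_derivative Q t (L (v x t))) (at t)" for t
        using bounded_linear.has_vector_derivative[OF L(1) v[of x t]] by (simp add: Q_def L)
    qed (simp add: v0)
    then show ?thesis by (simp add: S_def L)
  qed
  ultimately show ?thesis by blast
qed

text \<open>
  With \<open>G x\<close> the primitive of the orbit of \<open>x\<close>, one has \<open>T (G x 1) = U 1 x - x\<close>, and \<open>U 1 - I\<close> is
  invertible.  This replaces the improper Laplace integral of the Hille-Yosida theory.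
\<close>

lemma bounded_inverse_of_contraction:
  assumes q: "q < 1" "\<And>x. norm (U 1 x) \<le> q * norm x"
  shows "bij_betw T D UNIV" "\<exists>K\<ge>0. \<forall>x\<in>D. norm x \<le> K * norm (T x)"
proof -
  \<comment> \<open>\<open>q\<close> may be negative, whereas the fixed point theorem wants a
    nonnegative constant.\<close>
  have q1: "norm (U 1 x) \<le> max q 0 * norm x" for x
    by (rule order_trans[OF q(2)]) (simp add: mult_right_mono)
  define G where "G x = primitive (\<lambda>t. U t x)" for x
  have G0: "G x 0 = 0" and G: "(G x has_vector_derivative U t x) (at t)" for x t
    unfolding G_def using primitive_0[OF continuous_orbit] primitive_deriv[OF continuous_orbit] by blast+
  \<comment> \<open>The operator \<open>U h\<close> passes through the integral: both sides are
    primitives of \<open>U (t + h) x\<close> that vanish at \<open>t = 0\<close>. Differentiating at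
    \<open>h = 0\<close> with \<open>t = 1\<close> then gives \<open>T (G x 1)\<close>.\<close>
  have shift: "U h (G x t) = G x (t + h) - G x h" for x h t
  proof (rule vector_derivative_unique_primitive[where k = "\<lambda>t. U (t + h) x" and a = 0
        and f = "\<lambda>t. U h (G x t)" and g = "\<lambda>t. G x (t + h) - G x h"])
    fix t
    show "((\<lambda>t. U h (G x t)) has_vector_derivative U (t + h) x) (at t)"
      using bounded_linear.has_vector_derivative[OF bounded_linear G, of h x t]
      by (simp add: add[symmetric] add.commute)
    have "((\<lambda>t. t + h) has_vector_derivative 1) (at t)"
      by (auto intro!: derivative_eq_intros)
    from vector_diff_chain_at[OF this G[of x "t + h"]]
    have "((\<lambda>t. G x (t + h)) has_vector_derivative U (t + h) x) (at t)" by (simp add: o_def)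
    from has_vector_derivative_diff[OF this has_vector_derivative_const[of "G x h"]]
    show "((\<lambda>t. G x (t + h) - G x h) has_vector_derivative U (t + h) x) (at t)" by simp
  qed (simp add: G0 U_linear)
  have TG: "G x 1 \<in> D \<and> T (G x 1) = U 1 x - x" for x
  proof -
    have "((\<lambda>h. 1 + h) has_vector_derivative 1) (at 0)"
      by (auto intro!: derivative_eq_intros)
    moreover have "(G x has_vector_derivative U 1 x) (at (1 + 0))" using G[of x 1] by simp
    ultimately have "((\<lambda>h. G x (1 + h)) has_vector_derivative U 1 x) (at 0)"
      using vector_diff_chain_at[of "\<lambda>h. 1 + h" 1 0 "G x" "U 1 x"] by (simp add: o_def)
    from has_vector_derivative_diff[OF this G[of x 0]]
    show ?thesis by (simp add: generator[symmetric] shift zero)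
  qed
  obtain C where C: "C \<ge> 0" "\<And>t x. \<bar>t\<bar> \<le> 1 \<Longrightarrow> norm (U t x) \<le> C * norm x"
    using strongly_continuous_bounded[OF strongly_continuous] by blast
  have G_bound: "norm (G x 1) \<le> C * norm x" for x
    using norm_le_of_derivative_growth[OF G G0, of 1 x "C * norm x" 0 1] C by simp
  \<comment> \<open>If \<open>T (x - y) = 0\<close>, the orbit of \<open>x - y\<close> is constant,
    which a strict contraction at time 1 allows only for \<open>x - y = 0\<close>.\<close>
  have inj: "x = y" if "x \<in> D" "y \<in> D" "T x = T y" for x y
  proof -
    have "((\<lambda>t. U t (x - y)) has_vector_derivative 0) (at t)" for t
      using orbit_derivative[OF domain_diff(1)[OF that(1,2)], of t] that
      by (simp add: domain_diff U_linear)
    then have "U 1 (x - y) = U 0 (x - y)"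
      by (rule vector_derivative_unique_primitive[where k = "\<lambda>_. 0" and a = 0
            and f = "\<lambda>t. U t (x - y)" and g = "\<lambda>_. U 0 (x - y)"]) auto
    then have "norm (x - y) \<le> q * norm (x - y)" using q(2)[of "x - y"] by (simp add: zero)
    then show ?thesis using q(1) by (simp add: mult_le_cancel_right1)
  qed
  have surj: "\<exists>x\<in>D. T x = y \<and> norm x \<le> C / (1 - q) * norm y" for y
  proof -
    \<comment> \<open>The fixed point satisfies \<open>U 1 z - z = y\<close> and has norm at most
      \<open>norm y / (1 - q)\<close>. Then \<open>G z 1\<close> is the preimage of
      \<open>y\<close>, and the bound \<open>C\<close> on the integral over [0, 1] gives the
      constant \<open>C / (1 - q)\<close>.\<close>
    have "\<exists>!z. U 1 z - y = z"
    proof (rule banach_fix_type[of "max q 0"])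
      show "\<forall>a b. dist (U 1 a - y) (U 1 b - y) \<le> max q 0 * dist a b"
        using q1 by (simp add: dist_norm U_linear(2)[symmetric])
    qed (use q in auto)
    then obtain z where z: "U 1 z - y = z" by blast
    then have y: "U 1 z - z = y" by (metis add_diff_cancel_right' diff_add_cancel add.commute)
    have "norm z \<le> norm (U 1 z) + norm y" using norm_triangle_ineq4[of "U 1 z" y] z by simp
    then have "(1 - q) * norm z \<le> norm y" using q(2)[of z] by (simp add: algebra_simps)
    then have "norm z \<le> norm y / (1 - q)" using q(1) by (simp add: field_simps)
    then have "C * norm z \<le> C * (norm y / (1 - q))" using C(1) by (rule mult_left_mono)
    then have "norm (G z 1) \<le> C / (1 - q) * norm y" using G_bound[of z] by simp
    then show ?thesis using TG[of z] y by blast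
  qed
  show "bij_betw T D UNIV"
  proof (rule bij_betw_imageI)
    show "inj_on T D" by (rule inj_onI) (rule inj)
    have "y \<in> T ` D" for y using surj[of y] by auto
    then show "T ` D = UNIV" by auto
  qed
  show "\<exists>K\<ge>0. \<forall>x\<in>D. norm x \<le> K * norm (T x)"
  proof (intro exI[of _ "C / (1 - q)"] conjI ballI)
    show "norm x \<le> C / (1 - q) * norm (T x)" if "x \<in> D" for x
    proof -
      obtain z where z: "z \<in> D" "T z = T x" "norm z \<le> C / (1 - q) * norm (T x)"
        using surj[of "T x"] by auto
      then show ?thesis using inj[OF z(1) that z(2)] by simp
    qed
  qed (use C q in simp)
qed

section \<open>Resolvent, closedness and interpolation for a group generator\<close>

lemma resolvent_exists:
  "\<exists>(l::real) R. bounded_linear R \<and> (\<forall>y. R y \<in> D \<and> l *\<^sub>R R y - T (R y) = y) \<and>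
    (\<forall>x\<in>D. R (l *\<^sub>R x - T x) = x)"
proof -
  obtain C where C: "C \<ge> 0" "\<And>t x. \<bar>t\<bar> \<le> 1 \<Longrightarrow> norm (U t x) \<le> C * norm x"
    using strongly_continuous_bounded[OF strongly_continuous] by blast
  \<comment> \<open>With this choice \<open>exp l \<ge> 1 + l > C\<close>, so
    \<open>exp (- l) * C\<close>, which bounds the norm of the rescaled time-one map, is below
    1.\<close>
  define l where "l = C + 1"
  interpret R: group_generator "\<lambda>t x. exp (- l * t) *\<^sub>R U t x" D "\<lambda>x. T x + (- l) *\<^sub>R x"
    by (rule rescale)
  have "exp (- l) * C < 1"
  proof -
    have "C < exp l" using exp_ge_add_one_self[of l] C by (simp add: l_def)
    then show ?thesis by (simp add: exp_minus field_simps)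
  qed
  moreover have "norm (exp (- l * 1) *\<^sub>R U 1 x) \<le> exp (- l) * C * norm x" for x
    using C(2)[of 1 x] by (simp add: mult.assoc)
  ultimately have bij: "bij_betw (\<lambda>x. T x + (- l) *\<^sub>R x) D UNIV"
    and "\<exists>K\<ge>0. \<forall>x\<in>D. norm x \<le> K * norm (T x + (- l) *\<^sub>R x)"
    by (rule R.bounded_inverse_of_contraction)+
  then obtain K where K: "K \<ge> 0" "\<forall>x\<in>D. norm x \<le> K * norm (T x + (- l) *\<^sub>R x)" by blast
  have "bij_betw (uminus \<circ> (\<lambda>x. T x + (- l) *\<^sub>R x)) D UNIV"
    by (rule bij_betw_trans[OF bij]) (rule bij_uminus)
  moreover have "uminus \<circ> (\<lambda>x. T x + (- l) *\<^sub>R x) = (\<lambda>x. l *\<^sub>R x - T x)" by auto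
  ultimately have bij': "bij_betw (\<lambda>x. l *\<^sub>R x - T x) D UNIV" by simp
  define R where "R = inv_into D (\<lambda>x. l *\<^sub>R x - T x)"
  have R: "R y \<in> D" "l *\<^sub>R R y - T (R y) = y" for y
    using bij_betw_inv_into_right[OF bij'] bij_betwE[OF bij_betw_inv_into[OF bij']]
    by (auto simp: R_def)
  have R_eq: "R y = x" if "x \<in> D" "l *\<^sub>R x - T x = y" for x y
    using bij_betw_inv_into_left[OF bij' that(1)] that(2) by (simp add: R_def)
  have "bounded_linear R"
  proof (rule bounded_linear_intro)
    show "R (x + y) = R x + R y" for x y
    proof (rule R_eq)
      have "l *\<^sub>R (R x + R y) - T (R x + R y) = (l *\<^sub>R R x - T (R x)) + (l *\<^sub>R R y - T (R y))"
        by (simp add: domain_add R(1) scaleR_add_right)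
      then show "l *\<^sub>R (R x + R y) - T (R x + R y) = x + y" by (simp only: R(2))
    qed (intro domain_add R)
    show "R (c *\<^sub>R x) = c *\<^sub>R R x" for c x
    proof (rule R_eq)
      have "l *\<^sub>R (c *\<^sub>R R x) - T (c *\<^sub>R R x) = c *\<^sub>R (l *\<^sub>R R x - T (R x))"
        by (simp add: domain_scaleR R(1) scaleR_diff_right mult.commute)
      then show "l *\<^sub>R (c *\<^sub>R R x) - T (c *\<^sub>R R x) = c *\<^sub>R x" by (simp only: R(2))
    qed (intro domain_scaleR R)
    show "norm (R y) \<le> norm y * K" for y
    proof -
      have "norm (R y) \<le> K * norm (T (R y) + (- l) *\<^sub>R R y)" using K(2) R(1) by blast
      also have "T (R y) + (- l) *\<^sub>R R y = - y" using R(2)[of y] by (simp add: algebra_simps)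
      finally show ?thesis by (simp add: mult.commute)
    qed
  qed
  then show ?thesis using R R_eq by blast
qed

text \<open>The identity \<open>x n = R (l *\<^sub>R x n - T (x n))\<close> passes to the limit
  because \<open>R\<close> is bounded, and its limit lies in the range of \<open>R\<close>, hence in
  \<open>D\<close>.\<close>

lemma closed_graph:
  assumes "\<And>n. x n \<in> D" "x \<longlonglongrightarrow> a" "(\<lambda>n. T (x n)) \<longlonglongrightarrow> b"
  shows "a \<in> D" "T a = b"
proof -
  obtain l :: real and R where R: "bounded_linear R" "\<And>y. R y \<in> D"
    "\<And>y. l *\<^sub>R R y - T (R y) = y" "\<And>x. x \<in> D \<Longrightarrow> R (l *\<^sub>R x - T x) = x"
    using resolvent_exists by auto
  have "(\<lambda>n. R (l *\<^sub>R x n - T (x n))) \<longlonglongrightarrow> R (l *\<^sub>R a - b)"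
    by (intro bounded_linear.tendsto[OF R(1)] tendsto_intros assms)
  then have "x \<longlonglongrightarrow> R (l *\<^sub>R a - b)" by (simp add: R assms(1))
  then have a: "R (l *\<^sub>R a - b) = a" using assms(2) LIMSEQ_unique by blast
  then show "a \<in> D" using R(2) by metis
  show "T a = b" using R(3)[of "l *\<^sub>R a - b"] by (simp add: a)
qed

text \<open>Taylor expansion of the orbit: \<open>U h x - x - h *\<^sub>R T x\<close> is of order
  h^2 times the norm of \<open>T (T x)\<close>. Solving for \<open>T x\<close> and dividing by
  \<open>h\<close> leaves a coefficient of order h on the second derivative, which a small step
  makes less than \<open>e\<close>.\<close>

lemma interpolation:
  assumes "e > 0"
  shows "\<exists>C\<ge>0. \<forall>x. x \<in> D \<longrightarrow> T x \<in> D \<longrightarrow> norm (T x) \<le> e * norm (T (T x)) + C * norm x"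
proof -
  obtain M where M: "M \<ge> 0" "\<And>t x. \<bar>t\<bar> \<le> 1 \<Longrightarrow> norm (U t x) \<le> M * norm x"
    using strongly_continuous_bounded[OF strongly_continuous] by blast
  \<comment> \<open>At most 1, so that the bound \<open>M\<close> applies up to time
    \<open>h\<close>; at most \<open>e / (M + 1)\<close>, so that
    \<open>M * h \<le> e\<close>.\<close>
  define h where "h = min 1 (e / (M + 1))"
  have h: "0 < h" "h \<le> 1" "M * h \<le> e"
  proof -
    show "0 < h" "h \<le> 1" using assms M by (auto simp: h_def)
    have "M * h \<le> M * (e / (M + 1))" using M by (intro mult_left_mono) (auto simp: h_def)
    also have "\<dots> \<le> e" using M assms by (simp add: field_simps)
    finally show "M * h \<le> e" .
  qed
  have "norm (T x) \<le> e * norm (T (T x)) + ((M + 1) / h) * norm x" if x: "x \<in> D" "T x \<in> D" for x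
  proof -
    have 1: "norm (U s (T x) - T x) \<le> M * norm (T (T x)) * \<bar>s\<bar> ^ 1" if "\<bar>s\<bar> \<le> 1" for s
    proof -
      have "((\<lambda>s. U s (T x) - T x) has_vector_derivative U s (T (T x))) (at s)" for s
        using has_vector_derivative_diff[OF orbit_derivative[OF x(2)] has_vector_derivative_const]
        by simp
      from norm_le_of_derivative_growth[OF this, of 1 "M * norm (T (T x))" 0 s] that
      show ?thesis using M by (simp add: zero)
    qed
    have "((\<lambda>s. U s x - x - s *\<^sub>R T x) has_vector_derivative U s (T x) - T x) (at s)" for s
      by (auto intro!: derivative_eq_intros orbit_derivative x)
    from norm_le_of_derivative_growth[OF this _ 1, of h]
    have "norm (U h x - x - h *\<^sub>R T x) \<le> M * norm (T (T x)) * h ^ 2 / 2"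
      using h by (simp add: zero power2_eq_square)
    also have "\<dots> \<le> M * norm (T (T x)) * h ^ 2" using M by simp
    finally have "norm (h *\<^sub>R T x) \<le> norm (U h x - x) + M * norm (T (T x)) * h ^ 2"
      using norm_triangle_ineq4[of "U h x - x" "U h x - x - h *\<^sub>R T x"] by simp
    moreover have "norm (U h x - x) \<le> (M + 1) * norm x"
      using norm_triangle_ineq4[of "U h x" x] M(2)[of h x] h by (simp add: algebra_simps)
    ultimately have "h * norm (T x) \<le> (M + 1) * norm x + M * norm (T (T x)) * h ^ 2"
      using h by simp
    then have "norm (T x) \<le> ((M + 1) * norm x + M * norm (T (T x)) * h ^ 2) / h"
      using h by (simp add: field_simps)
    also have "\<dots> = (M + 1) / h * norm x + M * h * norm (T (T x))"
      using h by (simp add: field_simps power2_eq_square)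
    also have "\<dots> \<le> (M + 1) / h * norm x + e * norm (T (T x))"
      using h by (intro add_left_mono mult_right_mono) auto
    finally show ?thesis by simp
  qed
  then show ?thesis using M h by (intro exI[of _ "(M + 1) / h"]) auto
qed

end

text \<open>
  \<open>S \<circ> R\<close>, for a resolvent \<open>R\<close> of \<open>T\<close>, is a pointwise limit of the bounded difference quotients of
  \<open>V\<close>, so uniform boundedness does the work of the closed graph theorem.
\<close>

lemma relatively_bounded_of_domain_subset:
  assumes "group_generator U D T" "group_generator V E S" "D \<subseteq> E"
  shows "\<exists>C\<ge>0. \<forall>x\<in>D. norm (S x) \<le> C * (norm x + norm (T x))"
proof -
  interpret U: group_generator U D T by fact
  interpret V: group_generator V E S by fact
  obtain l :: real and R where R_lin: "bounded_linear R" and R: "\<And>y. R y \<in> D"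
    "\<And>x. x \<in> D \<Longrightarrow> R (l *\<^sub>R x - T x) = x"
    using U.resolvent_exists by auto
  define f where "f n y = real (Suc n) *\<^sub>R (V (1 / real (Suc n)) (R y) - R y)" for n y
  have f_lin: "bounded_linear (f n)" for n
    unfolding f_def
    by (intro bounded_linear_scaleR_right[THEN bounded_linear_compose] bounded_linear_sub
        bounded_linear_compose[OF V.bounded_linear] R_lin)
  have f_lim: "(\<lambda>n. f n y) \<longlonglongrightarrow> S (R y)" for y
  proof -
    have "((\<lambda>t. V t (R y)) has_vector_derivative S (R y)) (at 0)"
      using R(1)[of y] assms(3) by (auto simp: V.generator)
    then have "((\<lambda>h. (1 / h) *\<^sub>R (V h (R y) - V 0 (R y))) \<longlongrightarrow> S (R y)) (at 0)"
      by (simp add: has_vector_derivative_iff_quotient)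
    moreover have "filterlim (\<lambda>n. 1 / real (Suc n)) (at 0) sequentially"
      unfolding filterlim_at using LIMSEQ_Suc[OF lim_1_over_n] by (auto simp del: of_nat_Suc)
    ultimately show ?thesis
      using filterlim_compose unfolding f_def V.zero by fastforce
  qed
  have "\<exists>C\<ge>0. \<forall>n\<in>UNIV. \<forall>y. norm (f n y) \<le> C * norm y"
  proof (rule uniform_boundedness[OF f_lin])
    show "\<exists>K. \<forall>n\<in>UNIV. norm (f n y) \<le> K" for y
      using convergent_imp_Bseq[OF convergentI[OF f_lim[of y]]] by (auto simp: Bseq_def)
  qed
  then obtain C where C: "C \<ge> 0" "\<And>n y. norm (f n y) \<le> C * norm y" by blast
  have SR: "norm (S (R y)) \<le> C * norm y" for y
    by (rule LIMSEQ_le_const2[OF tendsto_norm[OF f_lim[of y]]]) (use C in auto)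
  have "norm (S x) \<le> C * (\<bar>l\<bar> + 1) * (norm x + norm (T x))" if "x \<in> D" for x
  proof -
    have "norm (S x) \<le> C * norm (l *\<^sub>R x - T x)" using SR[of "l *\<^sub>R x - T x"] R(2)[OF that] by simp
    also have "\<dots> \<le> C * (\<bar>l\<bar> * norm x + norm (T x))"
      using C(1) norm_triangle_ineq4[of "l *\<^sub>R x" "T x"] by (intro mult_left_mono) auto
    also have "\<dots> \<le> C * ((\<bar>l\<bar> + 1) * (norm x + norm (T x)))"
      using C(1) by (intro mult_left_mono) (auto simp: algebra_simps)
    finally show ?thesis by simp
  qed
  then show ?thesis using C by (intro exI[of _ "C * (\<bar>l\<bar> + 1)"]) auto
qed

lemma group_generator_Times:
  assumes "group_generator U D T" "group_generator V E S"
  shows "group_generator (\<lambda>t (x, y). (U t x, V t y)) (D \<times> E) (\<lambda>(x, y). (T x, S y))"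
proof -
  interpret U: group_generator U D T by fact
  interpret V: group_generator V E S by fact
  show ?thesis
  proof
    show "strongly_continuous (\<lambda>t (x, y). (U t x, V t y))"
      unfolding strongly_continuous_def split_beta
      by (intro conjI allI bounded_linear_Pair bounded_linear_compose[OF U.bounded_linear]
          bounded_linear_compose[OF V.bounded_linear] bounded_linear_fst bounded_linear_snd
          continuous_on_Pair U.continuous_orbit V.continuous_orbit)
    show "((\<lambda>t. case z of (x, y) \<Rightarrow> (U t x, V t y)) has_vector_derivative w) (at 0) \<longleftrightarrow>
        z \<in> D \<times> E \<and> (case z of (x, y) \<Rightarrow> (T x, S y)) = w" for z w
    proof -
      obtain x y u v where zw: "z = (x, y)" "w = (u, v)" by fastforce
      have "((\<lambda>t. (U t x, V t y)) has_vector_derivative (u, v)) (at 0) \<longleftrightarrow>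
          ((\<lambda>t. U t x) has_vector_derivative u) (at 0) \<and> ((\<lambda>t. V t y) has_vector_derivative v) (at 0)"
        unfolding has_vector_derivative_iff_quotient
        by (auto simp: dest: tendsto_fst tendsto_snd intro: tendsto_Pair)
      then show ?thesis by (auto simp: zw U.generator V.generator)
    qed
  qed (auto simp: U.zero V.zero U.add V.add)
qed

section \<open>Operators on a carrier\<close>

lemma
  assumes "clinear_on D T" "x \<in> D" "y \<in> D"
  shows clinear_on_add_mem: "x + y \<in> D"
    and clinear_on_add_eq: "T (x + y) = T x + T y"
  using assms by (auto simp: clinear_on_def complex_vector.subspace_add)

lemma
  assumes "clinear_on D T" "x \<in> D"
  shows clinear_on_scaleC_mem: "c *\<^sub>C x \<in> D"
    and clinear_on_scaleC_eq: "T (c *\<^sub>C x) = c *\<^sub>C T x"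
  using assms by (auto simp: clinear_on_def complex_vector.subspace_scale)

lemma
  assumes "clinear_on D T" "x \<in> D"
  shows clinear_on_scaleR_mem: "r *\<^sub>R x \<in> D"
    and clinear_on_scaleR_eq: "T (r *\<^sub>R x) = r *\<^sub>R T x"
  using clinear_on_scaleC_mem[OF assms] clinear_on_scaleC_eq[OF assms]
  by (simp_all add: scaleR_scaleC)

lemma
  assumes "clinear_on D T" "x \<in> D" "y \<in> D"
  shows clinear_on_diff_mem: "x - y \<in> D"
    and clinear_on_diff_eq: "T (x - y) = T x - T y"
  using clinear_on_add_mem[OF assms(1,2) clinear_on_scaleR_mem[OF assms(1,3), of "- 1"]]
    clinear_on_add_eq[OF assms(1,2) clinear_on_scaleR_mem[OF assms(1,3), of "- 1"]]
    clinear_on_scaleR_eq[OF assms(1,3), of "- 1"]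
  by simp_all

lemma
  assumes "clinear_on D T" "x \<in> D"
  shows clinear_on_minus_mem: "- x \<in> D"
    and clinear_on_minus_eq: "T (- x) = - T x"
  using clinear_on_scaleR_mem[OF assms, of "- 1"] clinear_on_scaleR_eq[OF assms, of "- 1"]
  by simp_all

lemmas clinear_on_simps = clinear_on_minus_mem clinear_on_minus_eq clinear_on_add_mem
  clinear_on_add_eq clinear_on_scaleC_mem
  clinear_on_scaleC_eq clinear_on_scaleR_mem clinear_on_scaleR_eq clinear_on_diff_mem
  clinear_on_diff_eq

lemma clinear_on_zero:
  assumes "clinear_on D T"
  shows "0 \<in> D" "T 0 = 0"
proof -
  show "0 \<in> D" using assms by (auto simp: clinear_on_def complex_vector.subspace_0)
  then show "T 0 = 0" using clinear_on_scaleR_eq[OF assms, of 0 0] by simp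
qed

lemma clinear_on_compose:
  assumes "clinear_on D S" "clinear_on E T"
  shows "clinear_on {x \<in> D. S x \<in> E} (\<lambda>x. T (S x))"
  using assms unfolding clinear_on_def[of "{x \<in> D. S x \<in> E}"] complex_vector.subspace_def
  by (auto simp: clinear_on_simps[OF assms(1)] clinear_on_simps[OF assms(2)]
      clinear_on_zero[OF assms(1)] clinear_on_zero[OF assms(2)])

lemma clinear_on_plus:
  assumes "clinear_on D S" "clinear_on D T"
  shows "clinear_on D (\<lambda>x. S x + T x)"
  using assms unfolding clinear_on_def by (simp add: scaleC_add_right)

lemma scaleC_minus_right: "c *\<^sub>C (- x) = - (c *\<^sub>C x)"
  by (rule complex_vector.scale_minus_right)

lemma scaleC_diff_right: "c *\<^sub>C (x - y) = c *\<^sub>C x - c *\<^sub>C y"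
  by (rule complex_vector.scale_right_diff_distrib)

lemma scaleC_scaleR: "c *\<^sub>C (r *\<^sub>R x) = r *\<^sub>R (c *\<^sub>C x)"
  by (simp add: scaleR_scaleC scaleC_scaleC mult.commute)

lemma clinear_on_diff:
  assumes "clinear_on D S" "clinear_on D T"
  shows "clinear_on D (\<lambda>x. S x - T x)"
  using assms unfolding clinear_on_def by (simp add: scaleC_diff_right)

lemma clinear_on_scaleR:
  assumes "clinear_on D T"
  shows "clinear_on D (\<lambda>x. r *\<^sub>R T x)"
  using assms unfolding clinear_on_def by (simp add: scaleR_add_right scaleC_scaleR)

lemma clinear_on_subset:
  assumes "clinear_on E T" "complex_vector.subspace D" "D \<subseteq> E"
  shows "clinear_on D T"
  using assms by (simp add: clinear_on_def subset_eq)

lemma clinear_on_cong: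
  assumes "clinear_on D S" "\<And>x. x \<in> D \<Longrightarrow> T x = S x"
  shows "clinear_on D T"
  using assms unfolding clinear_on_def
  by (auto simp: complex_vector.subspace_add complex_vector.subspace_scale)

lemma bounded_operator_compose:
  assumes "bounded_operator V N W M S" "bounded_operator W M Z L T" "\<And>x. x \<in> W \<Longrightarrow> 0 \<le> M x"
  shows "bounded_operator V N Z L (\<lambda>x. T (S x))"
proof -
  obtain b c where b: "\<forall>x\<in>V. M (S x) \<le> b * N x" and c: "\<forall>x\<in>W. L (T x) \<le> c * M x"
    using assms(1,2) by (auto simp: bounded_operator_def)
  have SW: "S x \<in> W" if "x \<in> V" for x using assms(1) that by (auto simp: bounded_operator_def)
  have "L (T (S x)) \<le> \<bar>c\<bar> * b * N x" if "x \<in> V" for x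
  proof -
    have "L (T (S x)) \<le> c * M (S x)" using c SW[OF that] by blast
    \<comment> \<open>\<open>bounded_operator\<close> puts no sign on its constant, so
      \<open>c\<close> has to be made nonnegative before the bound on \<open>S\<close> can be
      multiplied by it.\<close>
    also have "\<dots> \<le> \<bar>c\<bar> * M (S x)"
      using assms(3)[OF SW[OF that]] by (intro mult_right_mono) auto
    also have "\<dots> \<le> \<bar>c\<bar> * (b * N x)" using b that by (intro mult_left_mono) auto
    finally show ?thesis by simp
  qed
  moreover have "clinear_on V (\<lambda>x. T (S x))"
    using clinear_on_compose[of V S W T] assms(1,2) SW
    by (simp add: bounded_operator_def Collect_conj_eq Int_absorb2 subset_eq)
  ultimately show ?thesis using assms(2) SW by (auto simp: bounded_operator_def)
qed

lemma bounded_operator_plus: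
  assumes "bounded_operator V N UNIV norm S" "bounded_operator V N UNIV norm T"
  shows "bounded_operator V N UNIV norm (\<lambda>x. S x + T x :: 'a::complex_normed_vector)"
proof -
  obtain b c where "\<forall>x\<in>V. norm (S x) \<le> b * N x" "\<forall>x\<in>V. norm (T x) \<le> c * N x"
    using assms by (auto simp: bounded_operator_def)
  then have "norm (S x + T x) \<le> (b + c) * N x" if "x \<in> V" for x
    using that norm_triangle_ineq[of "S x" "T x"] by (fastforce simp: distrib_right)
  then show ?thesis using assms by (auto simp: bounded_operator_def clinear_on_plus)
qed

lemma bounded_operator_scaleR:
  assumes "bounded_operator V N UNIV norm T"
  shows "bounded_operator V N UNIV norm (\<lambda>x. r *\<^sub>R T x :: 'a::complex_normed_vector)"
proof -
  obtain c where "\<forall>x\<in>V. norm (T x) \<le> c * N x"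
    using assms by (auto simp: bounded_operator_def)
  then have "norm (r *\<^sub>R T x) \<le> (\<bar>r\<bar> * c) * N x" if "x \<in> V" for x
    using that by (simp add: mult.assoc mult_left_mono)
  then show ?thesis using assms by (auto simp: bounded_operator_def clinear_on_scaleR)
qed

text \<open>Dictionary between the carrier formulation of the hypotheses and the type-based calculus
  of bounded linear maps.\<close>

lemma bounded_operator_UNIV_iff:
  fixes T :: "'a::complex_normed_vector \<Rightarrow> 'b::complex_normed_vector"
  shows "bounded_operator UNIV norm UNIV norm T \<longleftrightarrow>
    bounded_linear T \<and> (\<forall>c x. T (c *\<^sub>C x) = c *\<^sub>C T x)"
proof
  assume T: "bounded_operator UNIV norm UNIV norm T"
  then have lin: "clinear_on UNIV T" by (simp add: bounded_operator_def)
  obtain C where "\<forall>x. norm (T x) \<le> C * norm x" using T by (auto simp: bounded_operator_def)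
  then have "bounded_linear T"
    by (intro bounded_linear_intro[of T C]) (auto simp: clinear_on_simps[OF lin] mult.commute)
  then show "bounded_linear T \<and> (\<forall>c x. T (c *\<^sub>C x) = c *\<^sub>C T x)"
    by (simp add: clinear_on_simps[OF lin])
next
  assume T: "bounded_linear T \<and> (\<forall>c x. T (c *\<^sub>C x) = c *\<^sub>C T x)"
  then obtain C where "\<forall>x. norm (T x) \<le> norm x * C" using bounded_linear.bounded by blast
  then show "bounded_operator UNIV norm UNIV norm T"
    using T by (auto simp: bounded_operator_def clinear_on_def linear_simps mult.commute)
qed

section \<open>Graph norms and closed operators\<close>

lemma graph_norm_nonneg: "0 \<le> graph_norm T x"
  by (simp add: graph_norm_def)

lemma
  assumes "clinear_on D T"
  shows bounded_operator_graph_norm_id: "bounded_operator D (graph_norm T) UNIV norm (\<lambda>x. x)"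
    and bounded_operator_graph_norm_self: "bounded_operator D (graph_norm T) UNIV norm T"
  using assms
  by (auto simp: bounded_operator_def clinear_on_def graph_norm_def intro!: exI[of _ 1])

text \<open>Convergence of \<open>x\<close> together with \<open>T x\<close> is convergence in the
  graph norm, for which \<open>S\<close> is continuous. The closedness proof uses this to pass
  \<open>B0\<close> and the lower order term to the limit.\<close>

lemma bounded_operator_graph_tendsto:
  assumes S: "bounded_operator D (graph_norm T) UNIV norm S" and T: "clinear_on D T"
    and x: "\<And>n. x n \<in> D" "a \<in> D" "x \<longlonglongrightarrow> a" "(\<lambda>n. T (x n)) \<longlonglongrightarrow> T a"
  shows "(\<lambda>n. S (x n)) \<longlonglongrightarrow> (S a :: 'b::complex_normed_vector)"
proof -
  obtain C where C: "\<And>z. z \<in> D \<Longrightarrow> norm (S z) \<le> C * graph_norm T z"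
    using S by (auto simp: bounded_operator_def)
  have lin: "clinear_on D S" using S by (simp add: bounded_operator_def)
  have "(\<lambda>n. C * (norm (x n - a) + norm (T (x n) - T a))) \<longlonglongrightarrow> C * (norm (a - a) + norm (T a - T a))"
    by (intro tendsto_intros x)
  moreover have "norm (S (x n) - S a) \<le> C * (norm (x n - a) + norm (T (x n) - T a))" for n
    using C[OF clinear_on_diff_mem[OF T x(1,2)], of n]
    by (simp add: graph_norm_def clinear_on_diff_eq[OF T x(1,2)] clinear_on_diff_eq[OF lin x(1,2)])
  ultimately have "(\<lambda>n. S (x n) - S a) \<longlonglongrightarrow> 0"
    by (intro Lim_null_comparison[of "\<lambda>n. S (x n) - S a"]) auto
  then show ?thesis by (simp add: LIM_zero_iff)
qed

lemma closed_operatorI: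
  assumes "clinear_on D T"
    and "\<And>x a b. \<lbrakk>\<And>n. x n \<in> D; x \<longlonglongrightarrow> a; (\<lambda>n. T (x n)) \<longlonglongrightarrow> b\<rbrakk> \<Longrightarrow> a \<in> D \<and> T a = b"
  shows "closed_operator D T"
  unfolding closed_operator_def closed_sequential_limits
proof (intro conjI allI impI assms(1))
  fix s l
  assume "(\<forall>n. s n \<in> (\<lambda>x. (x, T x)) ` D) \<and> s \<longlonglongrightarrow> l"
  then have mem: "s n \<in> (\<lambda>x. (x, T x)) ` D" and lim: "s \<longlonglongrightarrow> l" for n by auto
  have s: "fst (s n) \<in> D" "s n = (fst (s n), T (fst (s n)))" for n using mem[of n] by auto
  have "(\<lambda>n. fst (s n)) \<longlonglongrightarrow> fst l" by (intro tendsto_intros lim)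
  moreover have "(\<lambda>n. snd (s n)) \<longlonglongrightarrow> snd l" by (intro tendsto_intros lim)
  moreover have "snd (s n) = T (fst (s n))" for n using mem[of n] by auto
  ultimately have "fst l \<in> D \<and> T (fst l) = snd l" using assms(2)[of "\<lambda>n. fst (s n)"] s(1) by simp
  then show "l \<in> (\<lambda>x. (x, T x)) ` D" by (intro image_eqI[of l _ "fst l"]) (simp_all add: prod_eq_iff)
qed

lemma closed_operatorD:
  assumes "closed_operator D T" "\<And>n. x n \<in> D" "x \<longlonglongrightarrow> a" "(\<lambda>n. T (x n)) \<longlonglongrightarrow> b"
  shows "a \<in> D" "T a = b"
proof -
  have "(\<lambda>n. (x n, T (x n))) \<longlonglongrightarrow> (a, b)" by (intro tendsto_Pair assms)
  then have "(a, b) \<in> (\<lambda>x. (x, T x)) ` D"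
    using assms(1,2) unfolding closed_operator_def
    by (elim conjE closed_sequentially) auto
  then show "a \<in> D" "T a = b" by auto
qed

lemma banach_space_on_domain:
  assumes T: "closed_operator D T"
  shows "banach_space_on D (graph_norm T)"
  unfolding banach_space_on_def
proof (intro conjI allI impI)
  have lin: "clinear_on D T" using T by (simp add: closed_operator_def)
  show "normed_space_on D (graph_norm T)"
    unfolding normed_space_on_def
  proof (intro conjI ballI allI)
    show "complex_vector.subspace D" using lin by (simp add: clinear_on_def)
    show "graph_norm T (x + y) \<le> graph_norm T x + graph_norm T y" if "x \<in> D" "y \<in> D" for x y
      using norm_triangle_ineq[of x y] norm_triangle_ineq[of "T x" "T y"]
      by (simp add: graph_norm_def clinear_on_simps[OF lin] that)
    show "graph_norm T (c *\<^sub>C x) = cmod c * graph_norm T x" if "x \<in> D" for c x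
      by (simp add: graph_norm_def clinear_on_simps[OF lin] that norm_scaleC distrib_left)
    show "(graph_norm T x = 0) = (x = 0)" for x
      using clinear_on_zero[OF lin] by (auto simp: graph_norm_def add_nonneg_eq_0_iff)
  qed (simp add: graph_norm_nonneg)
  fix s :: "nat \<Rightarrow> 'a"
  assume "range s \<subseteq> D" and cauchy: "\<forall>e>0. \<exists>k. \<forall>m\<ge>k. \<forall>n\<ge>k. graph_norm T (s m - s n) < e"
  then have s: "s n \<in> D" for n by auto
  have eq: "graph_norm T (s m - a) = norm (s m - a) + norm (T (s m) - T a)" if "a \<in> D" for m a
    by (simp add: graph_norm_def clinear_on_diff_eq[OF lin s that])
  have "Cauchy f" if "\<And>m n. norm (f m - f n) \<le> graph_norm T (s m - s n)" for f :: "nat \<Rightarrow> 'a"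
    unfolding Cauchy_def dist_norm using cauchy that by (meson le_less_trans)
  from this[of s] this[of "\<lambda>n. T (s n)"] have "Cauchy s" "Cauchy (\<lambda>n. T (s n))"
    by (simp_all add: eq[OF s])
  then obtain a b where ab: "s \<longlonglongrightarrow> a" "(\<lambda>n. T (s n)) \<longlonglongrightarrow> b"
    by (meson Cauchy_convergent convergent_def)
  note a = closed_operatorD[OF T s ab]
  have "(\<lambda>n. norm (s n - a) + norm (T (s n) - T a)) \<longlonglongrightarrow> norm (a - a) + norm (T a - T a)"
    by (intro tendsto_intros ab(1) ab(2)[folded a(2)])
  then show "\<exists>x\<in>D. (\<lambda>n. graph_norm T (s n - x)) \<longlonglongrightarrow> 0"
    using a(1) by (intro bexI[of _ a]) (simp_all add: eq)
qed

section \<open>Generators on a carrier\<close>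

lemma bounded_linear_scaleC: "bounded_linear (\<lambda>x::'a::complex_normed_vector. c *\<^sub>C x)"
  by (rule bounded_linear_intro[of _ "cmod c"])
    (simp_all add: scaleC_add_right scaleC_scaleR norm_scaleC mult.commute)

lemma bounded_linear_scaleC_prod:
  "bounded_linear (\<lambda>x::'a::complex_normed_vector \<times> 'b::complex_normed_vector. c *\<^sub>C x)"
  unfolding scaleC_prod_def
  by (intro bounded_linear_Pair bounded_linear_compose[OF bounded_linear_scaleC]
      bounded_linear_fst bounded_linear_snd)

locale complex_group_generator = group_generator U D T
  for U :: "real \<Rightarrow> 'a::cbanach \<Rightarrow> 'a" and D T +
  assumes scaleC: "U t (c *\<^sub>C x) = c *\<^sub>C U t x"

lemma generates_C0_group_imp_group_generator:
  fixes T :: "'a::cbanach \<Rightarrow> 'a"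
  assumes "generates_C0_group UNIV norm D T"
  shows "\<exists>U. complex_group_generator U D T"
proof -
  obtain U where "C0_group UNIV norm U" and gen: "is_generator UNIV norm U D T"
    using assms by (auto simp: generates_C0_group_def)
  then have U: "bounded_operator UNIV norm UNIV norm (U t)" "U 0 x = x" "U (s + t) x = U s (U t x)"
    "((\<lambda>s. norm (U s x - U t x)) \<longlongrightarrow> 0) (at t)" for s t x
    by (auto simp: C0_group_def)
  have "complex_group_generator U D T"
  proof
    show "strongly_continuous U"
      using U(1,4) unfolding strongly_continuous_def continuous_on_def bounded_operator_UNIV_iff
      by (simp add: tendsto_norm_zero_iff LIM_zero_iff)
    show "((\<lambda>t. U t x) has_vector_derivative y) (at 0) \<longleftrightarrow> x \<in> D \<and> T x = y" for x y
      using gen unfolding has_vector_derivative_iff_quotient is_generator_def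
      by (simp add: tendsto_norm_zero_iff LIM_zero_iff U(2))
    show "U t (c *\<^sub>C x) = c *\<^sub>C U t x" for t c x
      using U(1) by (simp add: bounded_operator_UNIV_iff)
  qed (simp_all add: U)
  then show ?thesis by blast
qed

context complex_group_generator
begin

lemma clinear_on: "clinear_on D T"
proof -
  have "0 \<in> D" using generator[of 0 0] by (simp add: U_linear)
  moreover have "c *\<^sub>C x \<in> D" "T (c *\<^sub>C x) = c *\<^sub>C T x" if "x \<in> D" for c x
    using commuting_operator[OF bounded_linear_scaleC[of c] _ that] by (simp_all add: scaleC)
  ultimately show ?thesis
    by (auto simp: clinear_on_def complex_vector.subspace_def domain_add)
qed

lemma closed_operator: "closed_operator D T"
proof (rule closed_operatorI[OF clinear_on])
  show "a \<in> D \<and> T a = b"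
    if "\<And>n. x n \<in> D" "x \<longlonglongrightarrow> a" "(\<lambda>n. T (x n)) \<longlonglongrightarrow> b" for x a b
    using closed_graph[OF that] by blast
qed

text \<open>From T R = l R - I, boundedness of \<open>R\<close> improves to boundedness into the
  graph norm, so that \<open>R\<close> is an isomorphism of X onto the domain. Complex homogeneity
  follows from uniqueness of preimages.\<close>

lemma resolvent_graph_bounded:
  "\<exists>(l::real) R. bounded_operator UNIV norm D (graph_norm T) R \<and>
    (\<forall>y. l *\<^sub>R R y - T (R y) = y) \<and> (\<forall>x\<in>D. R (l *\<^sub>R x - T x) = x)"
proof -
  obtain l :: real and R where R: "bounded_linear R" "\<And>y. R y \<in> D"
    "\<And>y. l *\<^sub>R R y - T (R y) = y" "\<And>x. x \<in> D \<Longrightarrow> R (l *\<^sub>R x - T x) = x"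
    using resolvent_exists by auto
  have "R (c *\<^sub>C x) = c *\<^sub>C R x" for c x
  proof -
    have "l *\<^sub>R (c *\<^sub>C R x) - T (c *\<^sub>C R x) = c *\<^sub>C (l *\<^sub>R R x - T (R x))"
      by (simp add: clinear_on_simps[OF clinear_on] R(2) scaleC_diff_right scaleC_scaleR)
    then have "l *\<^sub>R (c *\<^sub>C R x) - T (c *\<^sub>C R x) = c *\<^sub>C x" by (simp only: R(3))
    then show ?thesis using R(4)[OF clinear_on_scaleC_mem[OF clinear_on R(2)], of c x] by simp
  qed
  then have R_lin: "clinear_on UNIV R"
    using R(1) by (simp add: clinear_on_def linear_simps)
  obtain K where K: "\<And>y. norm (R y) \<le> norm y * K"
    using bounded_linear.bounded[OF R(1)] by blast
  have "graph_norm T (R y) \<le> (K + \<bar>l\<bar> * K + 1) * norm y" for y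
  proof -
    have "T (R y) = l *\<^sub>R R y - y" using R(3)[of y] by (simp add: algebra_simps)
    then have "norm (T (R y)) \<le> \<bar>l\<bar> * norm (R y) + norm y"
      using norm_triangle_ineq4[of "l *\<^sub>R R y" y] by simp
    also have "\<dots> \<le> \<bar>l\<bar> * (norm y * K) + norm y"
      using K by (intro add_right_mono mult_left_mono) auto
    finally show ?thesis using K[of y] by (simp add: graph_norm_def algebra_simps)
  qed
  then have "bounded_operator UNIV norm D (graph_norm T) R"
    using R(2) R_lin by (auto simp: bounded_operator_def)
  then show ?thesis using R by blast
qed

lemma resolvent_set_nonempty: "resolvent_set D T \<noteq> {}"
proof -
  obtain l :: real and R where R: "bounded_operator UNIV norm D (graph_norm T) R"
    "\<And>y. l *\<^sub>R R y - T (R y) = y" "\<And>x. x \<in> D \<Longrightarrow> R (l *\<^sub>R x - T x) = x"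
    using resolvent_graph_bounded by auto
  have RD: "R y \<in> D" for y using R(1) by (auto simp: bounded_operator_def)
  have eq: "(\<lambda>x. complex_of_real l *\<^sub>C x - T x) = (\<lambda>x. l *\<^sub>R x - T x)"
    by (simp add: scaleR_scaleC)
  have bij: "bij_betw (\<lambda>x. l *\<^sub>R x - T x) D UNIV"
    by (rule bij_betw_byWitness[where f' = R]) (auto simp: R RD)
  have "inv_into D (\<lambda>x. l *\<^sub>R x - T x) y = R y" for y
    using bij_betw_inv_into_left[OF bij RD[of y]] by (simp add: R)
  then have "resolvent D T (complex_of_real l) = R"
    unfolding resolvent_def eq by blast
  moreover have "bounded_operator UNIV norm UNIV norm R"
    using bounded_operator_compose[OF R(1) bounded_operator_graph_norm_id[OF clinear_on] graph_norm_nonneg]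
    by simp
  ultimately have "complex_of_real l \<in> resolvent_set D T"
    using bij by (simp add: resolvent_set_def eq)
  then show ?thesis by blast
qed

end

text \<open>Similarity by \<open>J\<close>, with inverse \<open>K\<close>: the group on the carrier
  is \<open>K \<circ> S t \<circ> J\<close>. The two norm bounds make \<open>N\<close> equivalent to
  the norm of the image, so difference quotients converge on both sides at once, and
  \<open>D\<close> being the full preimage of \<open>D'\<close> in \<open>V\<close> makes the domain
  exact.\<close>

lemma generates_C0_group_transfer:
  fixes J :: "'v::complex_vector \<Rightarrow> 'b::{banach,complex_vector}"
  assumes S: "group_generator S D' T'" "\<And>t c z. S t (c *\<^sub>C z) = c *\<^sub>C S t z"
    and J: "clinear_on V J" "\<And>x. x \<in> V \<Longrightarrow> norm (J x) \<le> a * N x" "\<And>x. x \<in> V \<Longrightarrow> 0 \<le> N x"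
    and K: "\<And>z. K z \<in> V" "\<And>z. J (K z) = z" "\<And>x. x \<in> V \<Longrightarrow> K (J x) = x"
      "\<And>z. N (K z) \<le> b * norm z"
    and D: "D \<subseteq> V" "\<And>x. x \<in> V \<Longrightarrow> x \<in> D \<longleftrightarrow> J x \<in> D'"
    and T: "\<And>x. x \<in> D \<Longrightarrow> T x \<in> V" "\<And>x. x \<in> D \<Longrightarrow> J (T x) = T' (J x)"
  shows "generates_C0_group V N D T"
proof -
  interpret S: group_generator S D' T' by fact
  note J_simps = clinear_on_simps[OF J(1)]
  have inj: "x = y" if "x \<in> V" "y \<in> V" "J x = J y" for x y using K(3) that by metis
  have K_add: "K (y + z) = K y + K z" and K_scaleC: "K (c *\<^sub>C z) = c *\<^sub>C K z" for c y z
    by (rule inj; simp add: J_simps K)+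
  have tendsto_iff: "((\<lambda>h. N (w h)) \<longlongrightarrow> 0) F \<longleftrightarrow> ((\<lambda>h. J (w h)) \<longlongrightarrow> 0) F"
    if w: "\<And>h. w h \<in> V" for w :: "real \<Rightarrow> 'v" and F
  proof
    assume "((\<lambda>h. N (w h)) \<longlongrightarrow> 0) F"
    then have "((\<lambda>h. a * N (w h)) \<longlongrightarrow> 0) F" using tendsto_mult_right_zero by blast
    then show "((\<lambda>h. J (w h)) \<longlongrightarrow> 0) F"
      by (rule Lim_null_comparison[rotated]) (simp add: J w)
  next
    assume "((\<lambda>h. J (w h)) \<longlongrightarrow> 0) F"
    then have "((\<lambda>h. b * norm (J (w h))) \<longlongrightarrow> 0) F"
      by (intro tendsto_mult_right_zero tendsto_norm_zero)
    then show "((\<lambda>h. N (w h)) \<longlongrightarrow> 0) F"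
    proof (rule Lim_null_comparison[rotated])
      show "\<forall>\<^sub>F h in F. norm (N (w h)) \<le> b * norm (J (w h))"
        using K(4)[of "J (w _)"] by (simp add: K(3) w J(3))
    qed
  qed
  define U where "U t x = K (S t (J x))" for t x
  have U_V: "U t x \<in> V" and JU: "J (U t x) = S t (J x)" for t x by (simp_all add: U_def K)
  have "C0_group V N U"
    unfolding C0_group_def
  proof (intro conjI allI ballI)
    show "bounded_operator V N V N (U t)" for t
    proof -
      have "clinear_on V (U t)"
        unfolding clinear_on_def U_def
        using J(1) by (auto simp: clinear_on_def[of V J] S.U_linear S(2) K_add K_scaleC)
      moreover obtain c where c: "c \<ge> 0" "\<And>z. norm (S t z) \<le> norm z * c"
        using bounded_linear.nonneg_bounded[OF S.bounded_linear] by blast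
      have "N (U t x) \<le> (\<bar>b\<bar> * c * \<bar>a\<bar>) * N x" if x: "x \<in> V" for x
      proof -
        have "norm (J x) \<le> \<bar>a\<bar> * N x"
          by (rule order_trans[OF J(2)[OF x]]) (simp add: mult_right_mono J(3) x)
        then have "norm (J x) * c \<le> (\<bar>a\<bar> * N x) * c"
          using c(1) by (rule mult_right_mono)
        then have "\<bar>b\<bar> * norm (S t (J x)) \<le> \<bar>b\<bar> * ((\<bar>a\<bar> * N x) * c)"
          using c(2)[of "J x"] by (intro mult_left_mono) auto
        moreover have "N (U t x) \<le> \<bar>b\<bar> * norm (S t (J x))"
          unfolding U_def by (rule order_trans[OF K(4)]) (simp add: mult_right_mono)
        ultimately show ?thesis by (simp add: mult_ac)
      qed
      ultimately show ?thesis using U_V by (auto simp: bounded_operator_def)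
    qed
    show "U 0 x = x" if "x \<in> V" for x using that by (simp add: U_def S.zero K)
    show "U (s + t) x = U s (U t x)" for s t x by (simp add: U_def S.add K)
    show "((\<lambda>s. N (U s x - U t x)) \<longlongrightarrow> 0) (at t)" if "x \<in> V" for x t
    proof -
      have "((\<lambda>s. S s (J x)) \<longlongrightarrow> S t (J x)) (at t)"
        using S.continuous_orbit[of UNIV] by (simp add: continuous_on_def)
      then have "((\<lambda>s. S s (J x) - S t (J x)) \<longlongrightarrow> 0) (at t)" by (simp add: LIM_zero_iff)
      then show ?thesis by (subst tendsto_iff) (simp_all add: J_simps U_V JU)
    qed
  qed
  moreover have "is_generator V N U D T"
    unfolding is_generator_def
  proof (intro conjI ballI)
    show "((\<lambda>h. N ((1 / h) *\<^sub>R (U h x - x) - y)) \<longlongrightarrow> 0) (at 0) \<longleftrightarrow> x \<in> D \<and> T x = y"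
      if xy: "x \<in> V" "y \<in> V" for x y
    proof -
      have "((\<lambda>h. N ((1 / h) *\<^sub>R (U h x - x) - y)) \<longlongrightarrow> 0) (at 0) \<longleftrightarrow>
          ((\<lambda>h. (1 / h) *\<^sub>R (S h (J x) - J x) - J y) \<longlongrightarrow> 0) (at 0)"
        by (subst tendsto_iff) (simp_all add: J_simps U_V JU xy)
      also have "\<dots> \<longleftrightarrow> ((\<lambda>t. S t (J x)) has_vector_derivative J y) (at 0)"
        by (simp add: has_vector_derivative_iff_quotient S.zero LIM_zero_iff)
      also have "\<dots> \<longleftrightarrow> J x \<in> D' \<and> T' (J x) = J y" by (rule S.generator)
      also have "\<dots> \<longleftrightarrow> x \<in> D \<and> T x = y"
        using D(2)[OF xy(1)] T inj[OF _ xy(2)] by auto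
      finally show ?thesis .
    qed
  qed (use D T in auto)
  ultimately show ?thesis by (auto simp: generates_C0_group_def)
qed

section \<open>Commuting operators\<close>

text \<open>A single pair of resolvent points is enough. For y = (\<mu> - T)(\<nu> - S) u, one order
  of the resolvents sends y to u; hence so does the other, and undoing it gives y = (\<nu> -
  S)(\<mu> - T) u. The scalar terms cancel. The memberships of \<open>S u\<close> and
  \<open>T u\<close> in \<open>D\<close> make all these expressions legitimate.\<close>

lemma resolvents_commute_imp_commute:
  assumes S: "clinear_on D S" "resolvent_set D S \<noteq> {}"
    and T: "clinear_on E T" "resolvent_set E T \<noteq> {}"
    and comm: "resolvents_commute D S E T" and DE: "D \<subseteq> E"
    and u: "u \<in> D" "S u \<in> D" "T u \<in> D"
  shows "S (T u) = T (S u)"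
proof -
  obtain \<nu> \<mu> where \<nu>: "\<nu> \<in> resolvent_set D S" and \<mu>: "\<mu> \<in> resolvent_set E T" using S T by blast
  have inv: "resolvent D S \<nu> (\<nu> *\<^sub>C x - S x) = x" if "x \<in> D" for x
    using \<nu> that bij_betw_inv_into_left[of "\<lambda>x. \<nu> *\<^sub>C x - S x" D UNIV x]
    unfolding resolvent_set_def resolvent_def by simp
  have inv': "resolvent E T \<mu> (\<mu> *\<^sub>C x - T x) = x" if "x \<in> E" for x
    using \<mu> that bij_betw_inv_into_left[of "\<lambda>x. \<mu> *\<^sub>C x - T x" E UNIV x]
    unfolding resolvent_set_def resolvent_def by simp
  have right: "resolvent D S \<nu> y \<in> D" "\<nu> *\<^sub>C resolvent D S \<nu> y - S (resolvent D S \<nu> y) = y" for y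
    using \<nu> bij_betw_inv_into_right[of "\<lambda>x. \<nu> *\<^sub>C x - S x" D UNIV y]
      bij_betwE[OF bij_betw_inv_into[of "\<lambda>x. \<nu> *\<^sub>C x - S x" D UNIV]]
    unfolding resolvent_set_def resolvent_def by auto
  have right': "\<mu> *\<^sub>C resolvent E T \<mu> y - T (resolvent E T \<mu> y) = y" for y
    using \<mu> bij_betw_inv_into_right[of "\<lambda>x. \<mu> *\<^sub>C x - T x" E UNIV y]
    unfolding resolvent_set_def resolvent_def by auto
  define w where "w = \<nu> *\<^sub>C u - S u"
  define y where "y = \<mu> *\<^sub>C w - T w"
  have w: "w \<in> D" using u by (simp add: w_def clinear_on_simps[OF S(1)])
  have "resolvent D S \<nu> (resolvent E T \<mu> y) = u"
    using inv[OF u(1)] inv'[of w] w DE by (auto simp: y_def w_def)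
  then have "resolvent E T \<mu> (resolvent D S \<nu> y) = u"
    using comm \<nu> \<mu> by (simp add: resolvents_commute_def fun_eq_iff)
  then have "resolvent D S \<nu> y = \<mu> *\<^sub>C u - T u" using right'[of "resolvent D S \<nu> y"] by simp
  then have "\<nu> *\<^sub>C (\<mu> *\<^sub>C u - T u) - S (\<mu> *\<^sub>C u - T u) = y" using right(2)[of y] by simp
  moreover have "u \<in> E" "S u \<in> E" using u DE by auto
  ultimately show ?thesis
    using u by (simp add: y_def w_def clinear_on_simps[OF S(1)] clinear_on_simps[OF T(1)]
        scaleC_diff_right scaleC_scaleC mult.commute)
qed

lemma
  fixes T :: "'a::cbanach \<Rightarrow> 'a"
  assumes "generates_C0_group UNIV norm D T"
  shows generator_clinear_on: "clinear_on D T"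
    and generator_closed: "closed_operator D T"
    and generator_resolvent_set: "resolvent_set D T \<noteq> {}"
  using generates_C0_group_imp_group_generator[OF assms] complex_group_generator.clinear_on
    complex_group_generator.closed_operator complex_group_generator.resolvent_set_nonempty
  by blast+

lemma generator_relatively_bounded:
  fixes S T :: "'a::cbanach \<Rightarrow> 'a"
  assumes T: "generates_C0_group UNIV norm D T" and S: "generates_C0_group UNIV norm E S"
    and "D \<subseteq> E"
  shows "\<exists>C\<ge>0. \<forall>x\<in>D. norm (S x) \<le> C * (norm x + norm (T x))"
proof -
  obtain U V where "complex_group_generator U D T" "complex_group_generator V E S"
    using T S generates_C0_group_imp_group_generator by blast
  from this[THEN complex_group_generator.axioms(1)] show ?thesis
    using assms(3) by (rule relatively_bounded_of_domain_subset)
qed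

lemma (in complex_group_generator) bounded_perturbation:
  assumes P: "bounded_operator UNIV norm UNIV norm P"
  shows "\<exists>S. complex_group_generator S D (\<lambda>x. T x + P x)"
proof -
  have P: "bounded_linear P" "P (c *\<^sub>C x) = c *\<^sub>C P x" for c x
    using P by (simp_all add: bounded_operator_UNIV_iff)
  obtain S where S: "group_generator S D (\<lambda>x. T x + P x)"
    and comm: "\<And>L. bounded_linear L \<Longrightarrow> (\<forall>t x. L (U t x) = U t (L x)) \<Longrightarrow> (\<forall>x. L (P x) = P (L x)) \<Longrightarrow>
      \<forall>t x. L (S t x) = S t (L x)"
    using perturbation[OF P(1)] by blast
  have "\<forall>t x. c *\<^sub>C S t x = S t (c *\<^sub>C x)" for c
    by (rule comm[OF bounded_linear_scaleC]) (simp_all add: scaleC P)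
  then show ?thesis using S by (auto simp: complex_group_generator_def complex_group_generator_axioms_def)
qed

section \<open>Independence of the values outside the domain\<close>

lemma generates_C0_group_cong:
  assumes "\<And>x. x \<in> D \<Longrightarrow> T x = S x"
  shows "generates_C0_group V N D T \<longleftrightarrow> generates_C0_group V N D S"
proof -
  have "T ` D = S ` D" using assms by auto
  moreover have "x \<in> D \<and> T x = y \<longleftrightarrow> x \<in> D \<and> S x = y" for x y using assms by auto
  ultimately show ?thesis by (simp add: generates_C0_group_def is_generator_def)
qed

lemma closed_operator_cong:
  assumes "\<And>x. x \<in> D \<Longrightarrow> T x = S x"
  shows "closed_operator D T \<longleftrightarrow> closed_operator D S"
proof -
  have "(\<lambda>x. (x, T x)) ` D = (\<lambda>x. (x, S x)) ` D" using assms by auto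
  moreover have "clinear_on D T \<longleftrightarrow> clinear_on D S"
    using assms clinear_on_cong by metis
  ultimately show ?thesis by (simp add: closed_operator_def)
qed

lemma resolvent_set_cong:
  assumes "\<And>x. x \<in> D \<Longrightarrow> T x = S x"
  shows "resolvent_set D T = resolvent_set D S"
proof -
  have "inv_into D (\<lambda>x. \<mu> *\<^sub>C x - T x) = inv_into D (\<lambda>x. \<mu> *\<^sub>C x - S x)" for \<mu>
    unfolding inv_into_def by (intro ext arg_cong[where f = Eps]) (auto simp: assms fun_eq_iff)
  moreover have "bij_betw (\<lambda>x. \<mu> *\<^sub>C x - T x) D UNIV \<longleftrightarrow> bij_betw (\<lambda>x. \<mu> *\<^sub>C x - S x) D UNIV" for \<mu>
    by (intro bij_betw_cong) (simp add: assms)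
  ultimately show ?thesis by (simp add: resolvent_set_def resolvent_def)
qed

section \<open>Factorised second order generators\<close>

locale commuting_generators =
  fixes A0 B0 :: "'a::cbanach \<Rightarrow> 'a" and D E :: "'a set"
  assumes A0: "generates_C0_group UNIV norm D A0"
    and B0: "generates_C0_group UNIV norm E B0"
    and commute: "resolvents_commute D A0 E B0"
    and D_subset: "D \<subseteq> E"
    and B0_image: "B0 ` dom_square D A0 \<subseteq> D"
    and plus: "generates_C0_group UNIV norm D (\<lambda>x. A0 x - B0 x)"
    and minus: "generates_C0_group UNIV norm D (\<lambda>x. - A0 x - B0 x)"
begin

lemmas A0_lin = generator_clinear_on[OF A0]
lemmas A0_simps = clinear_on_simps[OF A0_lin]
lemmas B0_lin = clinear_on_subset[OF generator_clinear_on[OF B0] _ D_subset]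

lemma subspace_D: "complex_vector.subspace D"
  using A0_lin by (simp add: clinear_on_def)

lemmas B0_simps = clinear_on_simps[OF B0_lin[OF subspace_D]]

lemma dom_squareD: "x \<in> dom_square D A0 \<Longrightarrow> x \<in> D \<and> A0 x \<in> D \<and> B0 x \<in> D"
  using B0_image by (auto simp: dom_square_def)

lemma A0_B0: "x \<in> dom_square D A0 \<Longrightarrow> A0 (B0 x) = B0 (A0 x)"
  using dom_squareD[of x]
  by (intro resolvents_commute_imp_commute[OF A0_lin generator_resolvent_set[OF A0]
        generator_clinear_on[OF B0] generator_resolvent_set[OF B0] commute D_subset]) auto

lemma B0_bounded: "bounded_operator D (graph_norm A0) UNIV norm B0"
  using generator_relatively_bounded[OF A0 B0 D_subset] B0_lin[OF subspace_D]
  by (auto simp: bounded_operator_def graph_norm_def)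

section \<open>Closedness of the second order operator\<close>

lemma square_clinear_on:
  assumes "bounded_operator D (graph_norm A0) UNIV norm W"
  shows "clinear_on (dom_square D A0) (\<lambda>x. A0 (A0 x) - B0 (B0 x) + W x)"
proof -
  have A2: "clinear_on (dom_square D A0) (\<lambda>x. A0 (A0 x))"
    using clinear_on_compose[OF A0_lin A0_lin] by (simp add: dom_square_def)
  then have sub: "complex_vector.subspace (dom_square D A0)" by (simp add: clinear_on_def)
  have "clinear_on {x \<in> D. B0 x \<in> D} (\<lambda>x. B0 (B0 x))"
    by (intro clinear_on_compose B0_lin subspace_D)
  then have "clinear_on (dom_square D A0) (\<lambda>x. B0 (B0 x))"
    by (rule clinear_on_subset[OF _ sub]) (use dom_squareD in auto)
  moreover have "clinear_on (dom_square D A0) W"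
    using assms dom_squareD
    by (intro clinear_on_subset[OF _ sub, of D]) (auto simp: bounded_operator_def)
  ultimately show ?thesis using A2 by (intro clinear_on_plus clinear_on_diff)
qed

lemma square_estimate:
  assumes W: "bounded_operator D (graph_norm A0) UNIV norm W"
  shows "\<exists>m\<ge>0. \<forall>x\<in>dom_square D A0.
    norm (A0 (A0 x)) \<le> m * (norm (A0 (A0 x) - B0 (B0 x) + W x) + norm x + norm (A0 x))"
proof -
  obtain p where p: "p \<ge> 0" "\<And>z. z \<in> D \<Longrightarrow> norm (A0 z) \<le> p * (norm z + norm (A0 z - B0 z))"
    using generator_relatively_bounded[OF plus A0] by auto
  obtain q where q: "q \<ge> 0" "\<And>z. z \<in> D \<Longrightarrow> norm (A0 z) \<le> q * (norm z + norm (- A0 z - B0 z))"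
    using generator_relatively_bounded[OF minus A0] by auto
  obtain b where b: "b \<ge> 0" "\<And>z. z \<in> D \<Longrightarrow> norm (B0 z) \<le> b * (norm z + norm (A0 z))"
    using generator_relatively_bounded[OF A0 B0 D_subset] by auto
  obtain w' where w': "\<And>z. z \<in> D \<Longrightarrow> norm (W z) \<le> w' * graph_norm A0 z"
    using W by (auto simp: bounded_operator_def)
  define w where "w = \<bar>w'\<bar>"
  have w: "w \<ge> 0" "norm (W z) \<le> w * (norm z + norm (A0 z))" if "z \<in> D" for z
    using order_trans[OF w'[OF that] mult_right_mono[OF abs_ge_self graph_norm_nonneg]]
    by (simp_all add: w_def graph_norm_def)
  have "norm (A0 (A0 x)) \<le> q * (1 + p * (2 + b + w)) *
      (norm (A0 (A0 x) - B0 (B0 x) + W x) + norm x + norm (A0 x))"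
    if x: "x \<in> dom_square D A0" for x
  proof -
    define a y where "a = norm (A0 x) + norm x" and "y = norm (A0 (A0 x) - B0 (B0 x) + W x)"
    \<comment> \<open>The two factors are used one after the other. By commutation
      \<open>A0 z - B0 z\<close> is, up to sign, the second order part at \<open>x\<close>, so the
      estimate for \<open>plus\<close> bounds \<open>A0 z\<close>. Again by commutation
      \<open>A0 z\<close> is the generator in \<open>minus\<close> applied to \<open>A0 x\<close>,
      so the second estimate bounds \<open>A0 (A0 x)\<close>.\<close>
    define z where z_eq: "z = - A0 x - B0 x"
    have xD: "x \<in> D" "A0 x \<in> D" "B0 x \<in> D" using dom_squareD[OF x] by auto
    have z: "z \<in> D" "A0 z = - A0 (A0 x) - B0 (A0 x)" "A0 z - B0 z = - (A0 (A0 x) - B0 (B0 x))"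
      unfolding z_eq using xD A0_B0[OF x] by (simp_all add: A0_simps B0_simps)
    have "norm z \<le> norm (A0 x) + norm (B0 x)"
      using norm_triangle_ineq4[of "- A0 x" "B0 x"] by (simp add: z_eq)
    also have "\<dots> \<le> (1 + b) * a" using b(2)[OF xD(1)] by (simp add: a_def algebra_simps add_increasing)
    finally have nz: "norm z \<le> (1 + b) * a" .
    have "norm (A0 z - B0 z) \<le> y + norm (W x)"
      using norm_triangle_ineq4[of "A0 (A0 x) - B0 (B0 x) + W x" "W x"]
      unfolding z(3) norm_minus_cancel y_def by simp
    also have "\<dots> \<le> y + w * a" using w(2)[OF xD(1)] by (simp add: a_def add.commute)
    finally have "norm z + norm (A0 z - B0 z) \<le> y + (1 + b + w) * a"
      using nz by (simp add: algebra_simps)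
    then have "norm (A0 z) \<le> p * (y + (1 + b + w) * a)"
      using order_trans[OF p(2)[OF z(1)] mult_left_mono[OF _ p(1)]] by blast
    then have "norm (A0 x) + norm (- A0 (A0 x) - B0 (A0 x)) \<le> a + p * (y + (1 + b + w) * a)"
      unfolding z(2) a_def by (simp add: add_increasing)
    then have "norm (A0 (A0 x)) \<le> q * (a + p * (y + (1 + b + w) * a))"
      using order_trans[OF q(2)[OF xD(2)] mult_left_mono[OF _ q(1)]] by blast
    also have "\<dots> \<le> q * ((y + a) + p * ((2 + b + w) * (y + a)))"
    proof (intro mult_left_mono add_mono)
      have nn: "0 \<le> y" "0 \<le> a" by (simp_all add: y_def a_def)
      then show "a \<le> y + a" by simp
      have "0 \<le> (1 + b + w) * y" "0 \<le> a" using b w(1)[OF xD(1)] nn by simp_all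
      then show "y + (1 + b + w) * a \<le> (2 + b + w) * (y + a)" by (simp add: algebra_simps)
    qed (use p q in auto)
    finally show ?thesis by (simp add: y_def a_def algebra_simps)
  qed
  moreover have "0 \<le> w" by (simp add: w_def)
  then have "0 \<le> q * (1 + p * (2 + b + w))" using p q b by simp
  ultimately show ?thesis by blast
qed

text \<open>After absorption, both \<open>A0 x\<close> and \<open>A0 (A0 x)\<close> are controlled
  by the graph norm of the whole operator. A sequence converging in that graph norm therefore
  converges together with its images under \<open>A0\<close> and \<open>A0 \<circ> A0\<close>, and
  closedness of \<open>A0\<close>, applied twice, places the limit in the domain.\<close>

lemma square_closed:
  assumes W: "bounded_operator D (graph_norm A0) UNIV norm W"
  shows "closed_operator (dom_square D A0) (\<lambda>x. A0 (A0 x) - B0 (B0 x) + W x)"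
proof (rule closed_operatorI[OF square_clinear_on[OF W]])
  define A where "A x = A0 (A0 x) - B0 (B0 x) + W x" for x
  have A_lin: "clinear_on (dom_square D A0) A"
    using square_clinear_on[OF W] by (simp add: A_def[abs_def])
  obtain U where "complex_group_generator U D A0"
    using generates_C0_group_imp_group_generator[OF A0] by blast
  then interpret U: complex_group_generator U D A0 .
  obtain m where m: "m \<ge> 0" "\<And>x. x \<in> dom_square D A0 \<Longrightarrow>
      norm (A0 (A0 x)) \<le> m * (norm (A x) + norm x + norm (A0 x))"
    using square_estimate[OF W] unfolding A_def by blast
  \<comment> \<open>Chosen so that \<open>m * e \<le> 1 / 2\<close>: the term
    \<open>m * norm (A0 x)\<close> then costs at most half of \<open>norm (A0 (A0 x))\<close>, which
    moves to the left. The \<open>+ 2\<close> covers \<open>m = 0\<close>.\<close>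
  define e where "e = 1 / (2 * m + 2)"
  have e: "e > 0" "m * e \<le> 1 / 2" "e \<le> 1 / 2" using m(1) by (auto simp: e_def field_simps)
  obtain C where C: "C \<ge> 0" "\<And>x. x \<in> dom_square D A0 \<Longrightarrow>
      norm (A0 x) \<le> e * norm (A0 (A0 x)) + C * norm x"
    using U.interpolation[OF e(1)] by (auto simp: dom_square_def)
  have bound2: "norm (A0 (A0 x)) \<le> 2 * m * (1 + C) * (norm (A x) + norm x)"
    if x: "x \<in> dom_square D A0" for x
  proof -
    have "m * norm (A0 x) \<le> m * (e * norm (A0 (A0 x)) + C * norm x)"
      using C(2)[OF x] m(1) by (rule mult_left_mono)
    also have "\<dots> = (m * e) * norm (A0 (A0 x)) + m * C * norm x" by (simp add: algebra_simps)
    also have "\<dots> \<le> 1 / 2 * norm (A0 (A0 x)) + m * C * norm x"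
      using e(2) by (intro add_right_mono mult_right_mono) auto
    finally have "norm (A0 (A0 x)) \<le> 2 * m * (norm (A x) + norm x) + 2 * m * C * norm x"
      using m(2)[OF x] by (simp add: algebra_simps)
    moreover have "0 \<le> m * C * norm (A x)" using m(1) C(1) by simp
    ultimately show ?thesis by (simp add: algebra_simps)
  qed
  have bound1: "norm (A0 x) \<le> (2 * m * (1 + C) + C) * (norm (A x) + norm x)"
    if x: "x \<in> dom_square D A0" for x
  proof -
    have "e * norm (A0 (A0 x)) \<le> 1 * norm (A0 (A0 x))" using e by (intro mult_right_mono) auto
    then have "norm (A0 x) \<le> norm (A0 (A0 x)) + C * norm x" using C(2)[OF x] by simp
    also have "\<dots> \<le> 2 * m * (1 + C) * (norm (A x) + norm x) + C * (norm (A x) + norm x)"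
      using bound2[OF x] C(1) by (intro add_mono mult_left_mono) auto
    finally show ?thesis by (simp only: distrib_right)
  qed
  fix x a b
  assume x: "\<And>n. x n \<in> dom_square D A0" and xa: "x \<longlonglongrightarrow> a"
    and "(\<lambda>n. A0 (A0 (x n)) - B0 (B0 (x n)) + W (x n)) \<longlonglongrightarrow> b"
  then have Axb: "(\<lambda>n. A (x n)) \<longlonglongrightarrow> b" by (simp add: A_def)
  have xD: "x n \<in> D" "A0 (x n) \<in> D" "B0 (x n) \<in> D" for n using dom_squareD[OF x] by auto
  \<comment> \<open>Any additive \<open>F\<close> dominated by the graph norm of \<open>A\<close>
    maps the sequence to a Cauchy sequence; this serves \<open>A0\<close> and its square
    alike.\<close>
  have convergent: "convergent (\<lambda>n. F (x n))"
    if F: "\<And>z. z \<in> dom_square D A0 \<Longrightarrow> norm (F z) \<le> k * (norm (A z) + norm z)"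
      "\<And>m n. F (x m - x n) = F (x m) - F (x n)" for F :: "'a \<Rightarrow> 'a" and k
  proof -
    have "Cauchy (\<lambda>n. F (x n))"
    proof (rule metric_CauchyI)
      fix e :: real assume "e > 0"
      define K d where "K = \<bar>k\<bar> + 1" and "d = e / (2 * K)"
      have K: "K > 0" "k \<le> K" by (auto simp: K_def)
      then have d: "d > 0" "K * (d + d) = e" using \<open>e > 0\<close> by (auto simp: d_def field_simps)
      obtain M1 where M1: "\<And>m n. m \<ge> M1 \<Longrightarrow> n \<ge> M1 \<Longrightarrow> dist (x m) (x n) < d"
        using metric_CauchyD[OF LIMSEQ_imp_Cauchy[OF xa] d(1)] by blast
      obtain M2 where M2: "\<And>m n. m \<ge> M2 \<Longrightarrow> n \<ge> M2 \<Longrightarrow> dist (A (x m)) (A (x n)) < d"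
        using metric_CauchyD[OF LIMSEQ_imp_Cauchy[OF Axb] d(1)] by blast
      have "dist (F (x m)) (F (x n)) < e" if "m \<ge> max M1 M2" "n \<ge> max M1 M2" for m n
      proof -
        have "dist (F (x m)) (F (x n)) \<le> k * (norm (A (x m) - A (x n)) + norm (x m - x n))"
          using F(1)[OF clinear_on_diff_mem[OF A_lin x x]] F(2) clinear_on_diff_eq[OF A_lin x x]
          by (simp add: dist_norm)
        also have "\<dots> \<le> K * (norm (A (x m) - A (x n)) + norm (x m - x n))"
          using K by (intro mult_right_mono) auto
        also have "\<dots> < K * (d + d)"
          using M1[of m n] M2[of m n] that K
          by (intro mult_strict_left_mono add_strict_mono) (auto simp: dist_norm)
        also have "\<dots> = e" by (rule d(2))
        finally show ?thesis .
      qed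
      then show "\<exists>M. \<forall>m\<ge>M. \<forall>n\<ge>M. dist (F (x m)) (F (x n)) < e" by blast
    qed
    then show ?thesis by (rule Cauchy_convergent)
  qed
  have "convergent (\<lambda>n. A0 (x n))" "convergent (\<lambda>n. A0 (A0 (x n)))"
    using convergent[OF bound1] convergent[OF bound2] by (simp_all add: A0_simps xD)
  then obtain c d where c: "(\<lambda>n. A0 (x n)) \<longlonglongrightarrow> c" and d: "(\<lambda>n. A0 (A0 (x n))) \<longlonglongrightarrow> d"
    by (auto simp: convergent_def)
  have a: "a \<in> D" "A0 a = c" using U.closed_graph[OF xD(1) xa c] by auto
  have Aa: "A0 a \<in> D" "A0 (A0 a) = d" using U.closed_graph[OF xD(2) c d] a by auto
  have adom: "a \<in> dom_square D A0" using a Aa by (simp add: dom_square_def)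
  note lim = bounded_operator_graph_tendsto[OF _ A0_lin]
  have Bx: "(\<lambda>n. B0 (x n)) \<longlonglongrightarrow> B0 a" using c a by (intro lim[OF B0_bounded] xD xa) auto
  \<comment> \<open>Commutation turns this into convergence of \<open>A0 (B0 (x n))\<close>. Thus
    \<open>B0 (x n)\<close> converges in the graph norm of \<open>A0\<close>, and \<open>B0\<close>
    can be applied a second time.\<close>
  have "(\<lambda>n. B0 (A0 (x n))) \<longlonglongrightarrow> B0 (A0 a)"
    using c d a Aa by (intro lim[OF B0_bounded] xD) auto
  then have ABx: "(\<lambda>n. A0 (B0 (x n))) \<longlonglongrightarrow> A0 (B0 a)" by (simp add: A0_B0 x adom)
  have BBx: "(\<lambda>n. B0 (B0 (x n))) \<longlonglongrightarrow> B0 (B0 a)"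
    using dom_squareD[OF adom] by (intro lim[OF B0_bounded] xD Bx ABx) auto
  have Wx: "(\<lambda>n. W (x n)) \<longlonglongrightarrow> W a" using c a by (intro lim[OF W] xD xa) auto
  have "(\<lambda>n. A (x n)) \<longlonglongrightarrow> A a"
    unfolding A_def using d Aa by (intro tendsto_intros BBx Wx) simp
  then have "A a = b" using Axb LIMSEQ_unique by blast
  then show "a \<in> dom_square D A0 \<and> A0 (A0 a) - B0 (B0 a) + W a = b"
    using adom by (simp add: A_def)
qed

end

section \<open>Diagonalisation of the block operator on Y x X\<close>

context commuting_generators
begin

text \<open>\<open>L\<close> collects every term of the lower left entry that is of lower order than
  \<open>A0 \<circ> A0\<close>. The bounded part \<open>B1\<close> of the diagonal survives the
  change of coordinates because it preserves \<open>D\<close> boundedly: the conjugate C B1 R is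
  then bounded on X.\<close>

lemma first_order_system_generator:
  assumes L: "bounded_operator D (graph_norm A0) UNIV norm L"
    and B1: "bounded_operator UNIV norm UNIV norm B1"
    and B1_D: "bounded_operator D (graph_norm A0) D (graph_norm A0) B1"
  shows "generates_C0_group (D \<times> UNIV) (\<lambda>(u, v). graph_norm A0 u + norm v)
    (dom_square D A0 \<times> D)
    (\<lambda>(u, v). (- (B0 u + B1 u) + v, A0 (A0 u) + L u - (B0 v + B1 v)))"
proof -
  obtain UA where "complex_group_generator UA D A0"
    using generates_C0_group_imp_group_generator[OF A0] by blast
  then interpret UA: complex_group_generator UA D A0 .
  obtain l :: real and R where R: "bounded_operator UNIV norm D (graph_norm A0) R"
    "\<And>y. l *\<^sub>R R y - A0 (R y) = y" "\<And>x. x \<in> D \<Longrightarrow> R (l *\<^sub>R x - A0 x) = x"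
    using UA.resolvent_graph_bounded by auto
  have RD: "R y \<in> D" for y using R(1) by (auto simp: bounded_operator_def)
  define C where "C u = l *\<^sub>R u - A0 u" for u
  have CR: "C (R y) = y" and RC: "x \<in> D \<Longrightarrow> R (C x) = x" for x y by (simp_all add: C_def R)
  note id = bounded_operator_graph_norm_id[OF A0_lin]
    and A0_bd = bounded_operator_graph_norm_self[OF A0_lin]
  have C: "bounded_operator D (graph_norm A0) UNIV norm C"
    using bounded_operator_plus[OF bounded_operator_scaleR[OF id, of l]
        bounded_operator_scaleR[OF A0_bd, of "- 1"]]
    by (simp add: C_def[abs_def])
  then have C_lin: "clinear_on D C" by (simp add: bounded_operator_def)
  note C_simps = clinear_on_simps[OF C_lin]
  \<comment> \<open>Expanding C^2 = A0^2 - 2 l A0 + l^2 shows that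
    \<open>A0 (A0 u) + L u = C (C u) + F u\<close>; the term 2 l A0 is written as a sum.\<close>
  define F where "F u = l *\<^sub>R A0 u + l *\<^sub>R A0 u + (- l * l) *\<^sub>R u + L u" for u
  have F: "bounded_operator D (graph_norm A0) UNIV norm F"
    unfolding F_def by (intro bounded_operator_plus bounded_operator_scaleR id A0_bd L)
  \<comment> \<open>Composition with \<open>R\<close>, the inverse of \<open>C\<close>, turns maps
    that are bounded only for the graph norm into bounded maps of X.\<close>
  define FR where "FR x = F (R x)" for x
  define CBR where "CBR x = C (B1 (R x))" for x
  have FR: "bounded_linear FR" "FR (c *\<^sub>C x) = c *\<^sub>C FR x" for c x
    using bounded_operator_compose[OF R(1) F graph_norm_nonneg]
    unfolding bounded_operator_UNIV_iff by (simp_all add: FR_def[abs_def])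
  have CBR: "bounded_linear CBR" "CBR (c *\<^sub>C x) = c *\<^sub>C CBR x" for c x
    using bounded_operator_compose[OF bounded_operator_compose[OF R(1) B1_D graph_norm_nonneg]
        C graph_norm_nonneg]
    unfolding bounded_operator_UNIV_iff by (simp_all add: CBR_def[abs_def])
  have B1_bl: "bounded_linear B1" "B1 (c *\<^sub>C x) = c *\<^sub>C B1 x" for c x
    using B1 by (simp_all add: bounded_operator_UNIV_iff)
  \<comment> \<open>The inverse change of coordinates: at (v + C u, v - C u) these return
    \<open>C u\<close> and \<open>v\<close>.\<close>
  define h k :: "'a \<times> 'a \<Rightarrow> 'a"
    where "h z = (1 / 2) *\<^sub>R (fst z - snd z)" and "k z = (1 / 2) *\<^sub>R (fst z + snd z)" for z
  have hk: "bounded_linear h" "bounded_linear k"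
    unfolding h_def k_def
    by (intro bounded_linear_scaleR_right[THEN bounded_linear_compose] bounded_linear_sub
        bounded_linear_add bounded_linear_fst bounded_linear_snd)+
  have hk_scaleC: "h (c *\<^sub>C z) = c *\<^sub>C h z" "k (c *\<^sub>C z) = c *\<^sub>C k z" for c z
    by (simp_all add: h_def k_def scaleC_prod_def scaleC_scaleR scaleC_diff_right scaleC_add_right)
  \<comment> \<open>Everything in the new coordinates beyond diag(- A0 - B0, A0 - B0). The summands
    with \<open>l\<close> arise from C = l - A0, which also explains why the first coordinate
    carries \<open>- A0 - B0\<close>. The terms in \<open>CBR\<close> have opposite signs because
    they come from + C u and - C u.\<close>
  define P where "P z = (l *\<^sub>R fst z + FR (h z) - B1 (k z) - CBR (h z),
      - l *\<^sub>R snd z + FR (h z) - B1 (k z) + CBR (h z))" for z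
  have P: "bounded_linear P"
    unfolding P_def
    by (intro bounded_linear_Pair bounded_linear_add bounded_linear_sub
        bounded_linear_compose[OF bounded_linear_scaleR_right] bounded_linear_fst bounded_linear_snd
        bounded_linear_compose[OF FR(1) hk(1)] bounded_linear_compose[OF B1_bl(1) hk(2)]
        bounded_linear_compose[OF CBR(1) hk(1)])
  have P_scaleC: "P (c *\<^sub>C z) = c *\<^sub>C P z" for c z
    by (simp add: P_def hk_scaleC FR CBR B1_bl)
      (simp add: scaleC_prod_def scaleC_scaleR scaleC_diff_right scaleC_add_right scaleC_minus_right)
  obtain Um Up where "complex_group_generator Um D (\<lambda>x. - A0 x - B0 x)"
    and "complex_group_generator Up D (\<lambda>x. A0 x - B0 x)"
    using plus minus generates_C0_group_imp_group_generator by blast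
  then interpret Um: complex_group_generator Um D "\<lambda>x. - A0 x - B0 x"
    + Up: complex_group_generator Up D "\<lambda>x. A0 x - B0 x" .
  define T where "T = (\<lambda>(p, q). (- A0 p - B0 p, A0 q - B0 q))"
  interpret UT: group_generator "\<lambda>t (p, q). (Um t p, Up t q)" "D \<times> D" T
    unfolding T_def
    by (rule group_generator_Times[OF Um.group_generator_axioms Up.group_generator_axioms])
  obtain S where S: "group_generator S (D \<times> D) (\<lambda>z. T z + P z)"
    and comm: "\<And>L. bounded_linear L \<Longrightarrow>
      (\<forall>t z. L (case z of (p, q) \<Rightarrow> (Um t p, Up t q)) = (case L z of (p, q) \<Rightarrow> (Um t p, Up t q))) \<Longrightarrow>
      (\<forall>z. L (P z) = P (L z)) \<Longrightarrow> \<forall>t z. L (S t z) = S t (L z)"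
    using UT.perturbation[OF P] by blast
  \<comment> \<open>Complex linearity is inherited through the commutation clause of the
    perturbation result, since both diagonal groups and \<open>P\<close> are complex linear.\<close>
  have S_scaleC: "S t (c *\<^sub>C z) = c *\<^sub>C S t z" for t c z
  proof -
    have "\<forall>t z. c *\<^sub>C S t z = S t (c *\<^sub>C z)"
    proof (rule comm[OF bounded_linear_scaleC_prod])
      show "\<forall>t z. c *\<^sub>C (case z of (p, q) \<Rightarrow> (Um t p, Up t q)) =
          (case c *\<^sub>C z of (p, q) \<Rightarrow> (Um t p, Up t q))"
        by (simp add: scaleC_prod_def Um.scaleC Up.scaleC split: prod.split)
      show "\<forall>z. c *\<^sub>C P z = P (c *\<^sub>C z)" by (simp add: P_scaleC)
    qed
    then show ?thesis by metis
  qed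
  define J where "J = (\<lambda>(u, v). (v + C u, v - C u))"
  have hJ: "h (J (u, v)) = C u" and kJ: "k (J (u, v)) = v" for u v
  proof -
    have "v + C u - (v - C u) = 2 *\<^sub>R C u" "v + C u + (v - C u) = 2 *\<^sub>R v"
      by (simp_all add: scaleR_2)
    then show "h (J (u, v)) = C u" "k (J (u, v)) = v" by (simp_all add: J_def h_def k_def)
  qed
  obtain r where r: "\<And>x. graph_norm A0 (R x) \<le> r * norm x"
    using R(1) by (auto simp: bounded_operator_def)
  show ?thesis
  proof (rule generates_C0_group_transfer[OF S S_scaleC, of "D \<times> UNIV" J
        "2 * (\<bar>l\<bar> + 1)" _ "\<lambda>z. (R (h z), k z)" "\<bar>r\<bar> + 1"])
    show "clinear_on (D \<times> UNIV) J"
      unfolding clinear_on_def complex_vector.subspace_def J_def using clinear_on_zero[OF C_lin]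
      by (auto simp: C_simps scaleC_prod_def scaleC_add_right scaleC_diff_right zero_prod_def)
    show "norm (J x) \<le> 2 * (\<bar>l\<bar> + 1) * (case x of (u, v) \<Rightarrow> graph_norm A0 u + norm v)" for x
    proof -
      obtain u v where x: "x = (u, v)" by fastforce
      have "norm (J x) \<le> norm (v + C u) + norm (v - C u)"
        unfolding x J_def by (simp add: norm_Pair_le)
      also have "\<dots> \<le> 2 * (norm v + norm (C u))"
        using norm_triangle_ineq[of v "C u"] norm_triangle_ineq4[of v "C u"] by simp
      also have "norm (C u) \<le> \<bar>l\<bar> * norm u + norm (A0 u)"
        unfolding C_def using norm_triangle_ineq4[of "l *\<^sub>R u" "A0 u"] by simp
      also have "2 * (norm v + (\<bar>l\<bar> * norm u + norm (A0 u))) \<le>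
          2 * (\<bar>l\<bar> + 1) * (graph_norm A0 u + norm v)"
        by (simp add: graph_norm_def algebra_simps)
      finally show ?thesis by (simp add: x)
    qed
    show "0 \<le> (case x of (u, v) \<Rightarrow> graph_norm A0 u + norm v)" for x
      by (auto simp: graph_norm_nonneg split: prod.split)
    show "(R (h z), k z) \<in> D \<times> UNIV" for z by (simp add: RD)
    show "J (R (h z), k z) = z" for z
    proof -
      have "k z + h z = fst z" "k z - h z = snd z"
        unfolding h_def k_def scaleR_add_right[symmetric] scaleR_diff_right[symmetric]
        by (simp_all add: scaleR_2[symmetric])
      then show ?thesis by (simp add: J_def CR)
    qed
    show "(R (h (J x)), k (J x)) = x" if "x \<in> D \<times> UNIV" for x
      using that by (auto simp: hJ kJ RC)
    show "(case (R (h z), k z) of (u, v) \<Rightarrow> graph_norm A0 u + norm v) \<le> (\<bar>r\<bar> + 1) * norm z" for z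
    proof -
      have fs: "norm (fst z) \<le> norm z" "norm (snd z) \<le> norm z"
        using norm_fst_le[of "fst z" "snd z"] norm_snd_le[of "snd z" "fst z"] by simp_all
      have "norm (h z) \<le> norm z" "norm (k z) \<le> norm z"
        using norm_triangle_ineq4[of "fst z" "snd z"] norm_triangle_ineq[of "fst z" "snd z"] fs
        by (simp_all add: h_def k_def)
      moreover from this have "\<bar>r\<bar> * norm (h z) \<le> \<bar>r\<bar> * norm z" by (intro mult_left_mono) auto
      moreover have "graph_norm A0 (R (h z)) \<le> \<bar>r\<bar> * norm (h z)"
        by (rule order_trans[OF r]) (simp add: mult_right_mono)
      ultimately show ?thesis by (simp add: distrib_right)
    qed
    show "dom_square D A0 \<times> D \<subseteq> D \<times> UNIV" by (auto simp: dom_square_def)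
    \<comment> \<open>Half sum and half difference of the coordinates recover \<open>v\<close> and
      \<open>C u\<close>. For \<open>u\<close> in \<open>D\<close>, membership of \<open>C u\<close>
      in \<open>D\<close> is the same as membership of \<open>A0 u\<close>, which is how the square
      domain appears.\<close>
    show "x \<in> dom_square D A0 \<times> D \<longleftrightarrow> J x \<in> D \<times> D" if "x \<in> D \<times> UNIV" for x
    proof -
      from that obtain u v where x: "x = (u, v)" "u \<in> D" by auto
      have "A0 u \<in> D \<and> v \<in> D" if Jx: "v + C u \<in> D" "v - C u \<in> D"
      proof -
        have "k (J x) \<in> D" "h (J x) \<in> D"
          unfolding h_def k_def J_def x prod.case fst_conv snd_conv
          by (intro Jx clinear_on_scaleR_mem[OF A0_lin] clinear_on_add_mem[OF A0_lin]
              clinear_on_diff_mem[OF A0_lin])+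
        then have "v \<in> D" "C u \<in> D" by (simp_all add: x hJ kJ)
        moreover have "A0 u = l *\<^sub>R u - C u" by (simp add: C_def)
        ultimately show ?thesis using x by (simp add: A0_simps)
      qed
      moreover have "C u \<in> D" if "A0 u \<in> D" using x that by (simp add: C_def A0_simps)
      ultimately show ?thesis using x by (auto simp: J_def dom_square_def A0_simps)
    qed
    fix x assume "x \<in> dom_square D A0 \<times> D"
    then obtain u v where x: "x = (u, v)" "u \<in> dom_square D A0" "v \<in> D" by auto
    have u: "u \<in> D" "A0 u \<in> D" "B0 u \<in> D" using dom_squareD[OF x(2)] by auto
    have B1u: "B1 u \<in> D" using B1_D u(1) by (auto simp: bounded_operator_def)
    have Cu: "C u \<in> D" using u by (simp add: C_def A0_simps)
    let ?G = "\<lambda>(u, v). (- (B0 u + B1 u) + v, A0 (A0 u) + L u - (B0 v + B1 v))"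
    show "?G x \<in> D \<times> UNIV" using u B1u x by (simp add: A0_simps)
    \<comment> \<open>This is where commutation enters the diagonalisation: without it a term in the
      commutator of C and B0 would couple the two coordinates.\<close>
    have CB0: "C (B0 u) = B0 (C u)"
      using u A0_B0[OF x(2)] by (simp add: C_def B0_simps)
    have A0A0: "A0 (A0 u) + L u = C (C u) + F u"
      using u by (simp add: C_def F_def A0_simps scaleR_diff_right algebra_simps)
    have C_G: "C (v - (B0 u + B1 u)) = C v - (B0 (C u) + C (B1 u))"
      using u B1u x(3) by (simp add: C_simps CB0)
    have P_J: "P (J (u, v)) = (l *\<^sub>R (v + C u) + F u - B1 v - C (B1 u),
        - l *\<^sub>R (v - C u) + F u - B1 v + C (B1 u))"
      unfolding P_def hJ kJ FR_def CBR_def RC[OF u(1)] by (simp add: J_def)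
    have A0_C: "A0 y = l *\<^sub>R y - C y" for y by (simp add: C_def)
    show "J (?G x) = T (J x) + P (J x)"
      unfolding x(1) prod.case P_J A0A0 using x(3) Cu
      by (simp add: J_def T_def C_G A0_C C_simps B0_simps algebra_simps)
  qed
qed

end

theorem theorem2p3:
  fixes A0 B0 W0 B1 B1' A B :: "'a::cbanach \<Rightarrow> 'a"
    and dom_A0 dom_B0 dom_A dom_B :: "'a set"
  assumes "generates_C0_group UNIV norm dom_A0 A0"
    and "generates_C0_group UNIV norm dom_B0 B0"
    and "bounded_operator dom_A0 (graph_norm A0) UNIV norm W0"
    and "bounded_operator UNIV norm UNIV norm B1"
    and "bounded_operator UNIV norm UNIV norm B1'"
    and "resolvents_commute dom_A0 A0 dom_B0 B0"
    and "dom_A0 \<subseteq> dom_B0"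
    and "B0 ` dom_square dom_A0 A0 \<subseteq> dom_A0"
    and "generates_C0_group UNIV norm dom_A0 (\<lambda>x. A0 x - B0 x)"
    and "generates_C0_group UNIV norm dom_A0 (\<lambda>x. - A0 x - B0 x)"
    and "B1 ` dom_A0 \<subseteq> dom_A0"
    and "bounded_operator dom_A0 (graph_norm A0) dom_A0 (graph_norm A0) B1"
    and "\<forall>x\<in>dom_square dom_A0 A0. B0 (B1 x) - B1 (B0 x) = B1' x"
    and "dom_A = dom_square dom_A0 A0"
    and "\<forall>x\<in>dom_A. A x = A0 (A0 x) - B0 (B0 x) + W0 x"
    and "dom_B = dom_B0"
    and "\<forall>x\<in>dom_B. B x = B0 x + B1 x"
  shows "closed_operator dom_A A
    \<and> closed_operator dom_B B
    \<and> resolvent_set dom_B B \<noteq> {}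
    \<and> banach_space_on dom_A0 (graph_norm A0)
    \<and> continuously_embedded dom_A0 (graph_norm A0) UNIV norm
    \<and> dom_A \<subseteq> dom_square dom_B B \<inter> dom_A0
    \<and> B ` dom_A \<subseteq> dom_A0
    \<and> dom_A0 \<subseteq> dom_B
    \<and> generates_C0_group (dom_A0 \<times> UNIV) (\<lambda>(u, v). graph_norm A0 u + norm v)
        (dom_A \<times> dom_A0) (\<lambda>(u, v). (- B u + v, A u + B (B u) - B v))"
proof -
  note W0 = assms(3) and B1 = assms(4) and B1' = assms(5) and B1_D = assms(12)
    and commutator = assms(13) and dom_A = assms(14) and A = assms(15)
    and dom_B = assms(16) and B = assms(17)
  interpret commuting_generators A0 B0 dom_A0 dom_B0
    using assms by unfold_locales
  have dom_AD: "x \<in> dom_A0" "A0 x \<in> dom_A0" "B0 x \<in> dom_A0" if "x \<in> dom_A" for x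
    using dom_squareD that dom_A by auto
  have B1_mem: "B1 x \<in> dom_A0" if "x \<in> dom_A0" for x using assms(11) that by blast
  have B_eq: "B x = B0 x + B1 x" if "x \<in> dom_A0" for x using B D_subset dom_B that by blast
  have B_mem: "B x \<in> dom_A0" if "x \<in> dom_A" for x
    using dom_AD[OF that] B1_mem by (simp add: B_eq A0_simps)
  have "closed_operator dom_A A"
    using square_closed[OF W0] A dom_A
      closed_operator_cong[of dom_A A "\<lambda>x. A0 (A0 x) - B0 (B0 x) + W0 x"] by simp
  \<comment> \<open>\<open>B\<close> is a bounded perturbation of the group generator
    \<open>B0\<close>, so it generates a group on the same domain; both claims hold for every
    generator.\<close>
  moreover have "closed_operator dom_B B" "resolvent_set dom_B B \<noteq> {}"
  proof -
    obtain U where "complex_group_generator U dom_B0 B0"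
      using generates_C0_group_imp_group_generator[OF B0] by blast
    from complex_group_generator.bounded_perturbation[OF this B1]
    obtain S where "complex_group_generator S dom_B0 (\<lambda>x. B0 x + B1 x)" by blast
    then interpret S: complex_group_generator S dom_B0 "\<lambda>x. B0 x + B1 x" .
    show "closed_operator dom_B B" "resolvent_set dom_B B \<noteq> {}"
      using S.closed_operator S.resolvent_set_nonempty B dom_B
        closed_operator_cong[of dom_B B "\<lambda>x. B0 x + B1 x"]
        resolvent_set_cong[of dom_B B "\<lambda>x. B0 x + B1 x"] by simp_all
  qed
  moreover have "banach_space_on dom_A0 (graph_norm A0)"
    by (rule banach_space_on_domain[OF generator_closed[OF A0]])
  moreover have "continuously_embedded dom_A0 (graph_norm A0) UNIV norm"
    unfolding continuously_embedded_def by (auto simp: graph_norm_def intro!: exI[of _ 1])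
  moreover have "dom_A \<subseteq> dom_square dom_B B \<inter> dom_A0"
    using dom_AD B_mem D_subset by (auto simp: dom_B dom_square_def)
  moreover have "B ` dom_A \<subseteq> dom_A0" using B_mem by blast
  moreover have "dom_A0 \<subseteq> dom_B" using D_subset dom_B by simp
  moreover have "generates_C0_group (dom_A0 \<times> UNIV) (\<lambda>(u, v). graph_norm A0 u + norm v)
        (dom_A \<times> dom_A0) (\<lambda>(u, v). (- B u + v, A u + B (B u) - B v))"
  proof -
    define L where "L u = W0 u + 2 *\<^sub>R B1 (B0 u) + B1' u + B1 (B1 u)" for u
    note id = bounded_operator_graph_norm_id[OF A0_lin]
    have L: "bounded_operator dom_A0 (graph_norm A0) UNIV norm L"
      unfolding L_def
      by (intro bounded_operator_plus bounded_operator_scaleR W0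
          bounded_operator_compose[OF B0_bounded B1] bounded_operator_compose[OF id B1']
          bounded_operator_compose[OF bounded_operator_compose[OF id B1] B1]) simp_all
    have B1_bl: "bounded_linear B1" using B1 by (simp add: bounded_operator_UNIV_iff)
    have "A0 (A0 u) + L u = A u + B (B u)" if u: "u \<in> dom_A" for u
    proof -
      \<comment> \<open>The commutator hypothesis rewrites the one mixed term of
        \<open>B (B u)\<close> in which \<open>B0\<close> acts last. The remaining
        \<open>B0 (B0 u)\<close> cancels against the one in \<open>A\<close>.\<close>
      have "B0 (B1 u) = B1 (B0 u) + B1' u"
        using commutator u dom_A by (simp add: algebra_simps)
      then have "B (B u) = B0 (B0 u) + 2 *\<^sub>R B1 (B0 u) + B1' u + B1 (B1 u)"
        using dom_AD[OF u] B1_mem[OF dom_AD(1)[OF u]] B_mem[OF u]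
        by (simp add: B_eq B0_simps linear_simps[OF B1_bl] scaleR_2 algebra_simps)
      then show ?thesis using A u by (simp add: L_def)
    qed
    then have "(case z of (u, v) \<Rightarrow> (- (B0 u + B1 u) + v, A0 (A0 u) + L u - (B0 v + B1 v))) =
        (case z of (u, v) \<Rightarrow> (- B u + v, A u + B (B u) - B v))" if "z \<in> dom_A \<times> dom_A0" for z
      using that dom_AD B_eq by auto
    from generates_C0_group_cong[OF this]
    show ?thesis using first_order_system_generator[OF L B1 B1_D] by (simp add: dom_A)
  qed
  ultimately show ?thesis by blast
qed

end
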